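(* Let $\Omega\subset\mathbf{R}^n$ be a nonempty open set, which may be unbounded. Let $E\subset\Omega$ be a relatively closed set with $C_{s,p}(E)=0$. Assume that $f\in V^{s,p}_0(\Omega)^*$ and that $u\in V^{s,p}(\Omega\setminus E)$ is a solution (resp. supersolution) of $\mathcal{L}u=f$ in $\Omega\setminus E$. Then $u$ is a solution (resp. supersolution) of $\mathcal{L}u=f$ in $\Omega$.
   Context: Standing assumptions: $n\ge1$, $0<s<1$, $1<p<\infty$, $\Lambda\ge1$, and $k:\mathbf{R}^n\times\mathbf{R}^n\to[0,\infty]$ is a symmetric measurable kernel with $\Lambda^{-1}|x-y|^{-n-sp}\le k(x,y)\le\Lambda|x-y|^{-n-sp}$. The operator is $\mathcal{L}u(x)=2\,\mathrm{p.v.}\int_{\mathbf{R}^n}|u(x)-u(y)|^{p-2}(u(x)-u(y))k(x,y)\,dy$. For a nonempty open set $G\subset\mathbf{R}^n$: $W^{s,p}(G)$ consists of the measurable $u$ with $\|u\|_{W^{s,p}(G)}^p=\|u\|_{L^p(G)}^p+\int_G\int_G\frac{|u(x)-u(y)|^p}{|x-y|^{n+sp}}\,dy\,dx<\infty$; $W^{s,p}_{\rm loc}(G)$ consists of the functions in $W^{s,p}(G')$ for every open $G'\Subset G$. $L^{p-1}_{sp}(\mathbf{R}^n)$ is the set of measurable $u$ with $\int_{\mathbf{R}^n}\frac{|u(y)|^{p-1}}{(1+|y|)^{n+sp}}\,dy<\infty$. $V^{s,p}(G)$ is the space of measurable $u:\mathbf{R}^n\to[-\infty,\infty]$ (finite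 a.e.) with $\|u\|_{V^{s,p}(G)}=\bigl(\int_G|u|^p\,dx+\int_G\int_{\mathbf{R}^n}\frac{|u(x)-u(y)|^p}{|x-y|^{n+sp}}\,dy\,dx\bigr)^{1/p}<\infty$; $V^{s,p}_0(G)$ is the closure of $C_c^\infty(G)$ in $V^{s,p}(G)$ (its elements being identically $0$ outside $G$), and $V^{s,p}_0(G)^*$ is its dual space. Let $\mathcal{E}(u,v)=\int_{\mathbf{R}^n}\int_{\mathbf{R}^n}|u(x)-u(y)|^{p-2}(u(x)-u(y))(v(x)-v(y))k(x,y)\,dy\,dx$. A function $u\in W^{s,p}_{\rm loc}(G)\cap L^{p-1}_{sp}(\mathbf{R}^n)$ is a solution (resp. supersolution) of $\mathcal{L}u=f$ in $G$ if $\mathcal{E}(u,\varphi)\ge\langle f,\varphi\rangle$ for all $\varphi\in C_c^\infty(G)$ (resp. for all nonnegative $\varphi\in C_c^\infty(G)$). Here $\langle f,\varphi\rangle$ is the duality pairing; when $f$ is given by a measurable function it is $\int f\varphi\,dx$. Sobolev capacity. For compact $K\subset\mathbf{R}^n$, $C_{s,p}(K)=\inf\|u\|_{W^{s,p}(\mathbf{R}^n)}^p$ over all $u\in C_c^\infty(\mathbf{R}^n)$ with $u\ge1$ on $K$; for open $G$, $C_{s,p}(G)=\sup\{C_{s,p}(K):K\subset G\text{ compact}\}$; for arbitrary $E$, $C_{s,p}(E)=\inf\{C_{s,p}(G):G\supset E\text{ open}\}$. *)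

theory Defs
  imports "HOL-Analysis.Analysis"
begin

text \<open>
  The space \<open>R^n\<close>, \<open>n \<ge> 1\<close>, is an arbitrary type \<open>'a :: euclidean_space\<close> with \<open>n = DIM('a)\<close>.
  Measurability and integrals refer to Lebesgue measure.  Functions with values in \<open>[-\<infinity>,\<infinity>]\<close> have
  type \<open>'a \<Rightarrow> ereal\<close>; membership in the spaces below makes them finite a.e. (on the relevant set),
  and integrals are taken of the representative \<open>real_of_ereal \<circ> u\<close>, which differs from \<open>u\<close> only
  where \<open>u\<close> is infinite.  Note that \<open>0 powr a = 0\<close> and \<open>a / 0 = 0\<close>, so all the difference quotients
  below vanish on the diagonal, which is a null set.
\<close>

primrec C_k :: "nat \<Rightarrow> ('a::euclidean_space \<Rightarrow> real) \<Rightarrow> bool" where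
  "C_k 0 \<phi> \<longleftrightarrow> continuous_on UNIV \<phi>"
| "C_k (Suc m) \<phi> \<longleftrightarrow>
     \<phi> differentiable_on UNIV \<and> (\<forall>v. C_k m (\<lambda>x. frechet_derivative \<phi> (at x) v))"

definition Cc_infty :: "'a::euclidean_space set \<Rightarrow> ('a \<Rightarrow> real) set" where
  "Cc_infty G = {\<phi>. (\<forall>m. C_k m \<phi>) \<and>
     compact (closure {x. \<phi> x \<noteq> 0}) \<and> closure {x. \<phi> x \<noteq> 0} \<subseteq> G}"

text \<open>The \<open>p\<close>-th power of the norm of \<open>W^{s,p}(G)\<close>, possibly infinite.\<close>
definition W_norm_pow ::
    "real \<Rightarrow> real \<Rightarrow> 'a::euclidean_space set \<Rightarrow> ('a \<Rightarrow> real) \<Rightarrow> ennreal" where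
  "W_norm_pow s p G u =
     (\<integral>\<^sup>+x\<in>G. ennreal (\<bar>u x\<bar> powr p) \<partial>lebesgue) +
     (\<integral>\<^sup>+x\<in>G. (\<integral>\<^sup>+y\<in>G.
        ennreal (\<bar>u x - u y\<bar> powr p / norm (x - y) powr (real DIM('a) + s * p)) \<partial>lebesgue) \<partial>lebesgue)"

definition W_space ::
    "real \<Rightarrow> real \<Rightarrow> 'a::euclidean_space set \<Rightarrow> ('a \<Rightarrow> ereal) set" where
  "W_space s p G = {u. u \<in> borel_measurable (lebesgue_on G) \<and>
     (AE x in lebesgue. x \<in> G \<longrightarrow> \<bar>u x\<bar> \<noteq> \<infinity>) \<and>
     W_norm_pow s p G (real_of_ereal \<circ> u) < \<infinity>}"

definition W_loc ::
    "real \<Rightarrow> real \<Rightarrow> 'a::euclidean_space set \<Rightarrow> ('a \<Rightarrow> ereal) set" where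
  "W_loc s p G = {u. \<forall>G'. open G' \<and> compact (closure G') \<and> closure G' \<subseteq> G \<longrightarrow> u \<in> W_space s p G'}"

text \<open>The tail space \<open>L^{p-1}_{sp}(R^n)\<close>.\<close>
definition L_tail :: "real \<Rightarrow> real \<Rightarrow> ('a::euclidean_space \<Rightarrow> ereal) set" where
  "L_tail s p = {u. u \<in> borel_measurable lebesgue \<and>
     (AE y in lebesgue. \<bar>u y\<bar> \<noteq> \<infinity>) \<and>
     (\<integral>\<^sup>+y. ennreal (\<bar>real_of_ereal (u y)\<bar> powr (p - 1) /
               (1 + norm y) powr (real DIM('a) + s * p)) \<partial>lebesgue) < \<infinity>}"

definition V_norm_pow ::
    "real \<Rightarrow> real \<Rightarrow> 'a::euclidean_space set \<Rightarrow> ('a \<Rightarrow> real) \<Rightarrow> ennreal" where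
  "V_norm_pow s p G u =
     (\<integral>\<^sup>+x\<in>G. ennreal (\<bar>u x\<bar> powr p) \<partial>lebesgue) +
     (\<integral>\<^sup>+x\<in>G. (\<integral>\<^sup>+y.
        ennreal (\<bar>u x - u y\<bar> powr p / norm (x - y) powr (real DIM('a) + s * p)) \<partial>lebesgue) \<partial>lebesgue)"

definition V_space ::
    "real \<Rightarrow> real \<Rightarrow> 'a::euclidean_space set \<Rightarrow> ('a \<Rightarrow> ereal) set" where
  "V_space s p G = {u. u \<in> borel_measurable lebesgue \<and>
     (AE x in lebesgue. \<bar>u x\<bar> \<noteq> \<infinity>) \<and>
     V_norm_pow s p G (real_of_ereal \<circ> u) < \<infinity>}"

definition V_norm ::
    "real \<Rightarrow> real \<Rightarrow> 'a::euclidean_space set \<Rightarrow> ('a \<Rightarrow> real) \<Rightarrow> real" where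
  "V_norm s p G u = enn2real (V_norm_pow s p G u) powr (1 / p)"

text \<open>
  The space \<open>V_0^{s,p}(G)\<close>, given by its real-valued representatives, so that it is a vector space
  of functions.
\<close>
definition V0_space ::
    "real \<Rightarrow> real \<Rightarrow> 'a::euclidean_space set \<Rightarrow> ('a \<Rightarrow> real) set" where
  "V0_space s p G = {v. (\<lambda>x. ereal (v x)) \<in> V_space s p G \<and> (\<forall>x. x \<notin> G \<longrightarrow> v x = 0) \<and>
     (\<forall>\<epsilon>>0. \<exists>\<phi>\<in>Cc_infty G. V_norm s p G (\<lambda>x. v x - \<phi> x) < \<epsilon>)}"

text \<open>
  Bounded linear functionals on \<open>V_0^{s,p}(G)\<close>; only the values on that space matter.  Boundedness
  and linearity imply that such a functional respects equality a.e.
\<close>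
definition V0_dual ::
    "real \<Rightarrow> real \<Rightarrow> 'a::euclidean_space set \<Rightarrow> (('a \<Rightarrow> real) \<Rightarrow> real) set" where
  "V0_dual s p G = {f.
     (\<forall>v\<in>V0_space s p G. \<forall>w\<in>V0_space s p G. f (\<lambda>x. v x + w x) = f v + f w) \<and>
     (\<forall>c. \<forall>v\<in>V0_space s p G. f (\<lambda>x. c * v x) = c * f v) \<and>
     (\<exists>C. \<forall>v\<in>V0_space s p G. \<bar>f v\<bar> \<le> C * V_norm s p G v)}"

text \<open>The bounds are imposed only off the diagonal; on it, \<open>k\<close> may be infinite.\<close>
definition nonlocal_kernel ::
    "real \<Rightarrow> real \<Rightarrow> real \<Rightarrow> ('a::euclidean_space \<Rightarrow> 'a \<Rightarrow> ennreal) \<Rightarrow> bool" where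
  "nonlocal_kernel s p \<Lambda> k \<longleftrightarrow>
     (\<lambda>(x, y). k x y) \<in> borel_measurable (lebesgue :: ('a \<times> 'a) measure) \<and>
     (\<forall>x y. k x y = k y x) \<and>
     (\<forall>x y. x \<noteq> y \<longrightarrow>
        ennreal (norm (x - y) powr (- real DIM('a) - s * p) / \<Lambda>) \<le> k x y \<and>
        k x y \<le> ennreal (\<Lambda> * norm (x - y) powr (- real DIM('a) - s * p)))"

definition energy ::
    "('a::euclidean_space \<Rightarrow> 'a \<Rightarrow> ennreal) \<Rightarrow> real \<Rightarrow> ('a \<Rightarrow> real) \<Rightarrow> ('a \<Rightarrow> real) \<Rightarrow> real" where
  "energy k p u v =
     (LINT x|lebesgue. (LINT y|lebesgue.
        \<bar>u x - u y\<bar> powr (p - 2) * (u x - u y) * (v x - v y) * enn2real (k x y)))"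

text \<open>
  Solutions and supersolutions of \<open>\<L>u = f\<close> in \<open>G\<close>, where \<open>f \<phi>\<close> is the pairing \<open>\<langle>f,\<phi>\<rangle>\<close>.  Since \<open>\<phi>\<close> may
  be replaced by \<open>-\<phi>\<close>, the inequality for solutions amounts to equality.  The double integral in the
  energy converges absolutely for all \<open>u\<close> and \<open>\<phi>\<close> considered here.
\<close>
definition is_solution ::
    "('a::euclidean_space \<Rightarrow> 'a \<Rightarrow> ennreal) \<Rightarrow> real \<Rightarrow> real \<Rightarrow> 'a set \<Rightarrow>
     (('a \<Rightarrow> real) \<Rightarrow> real) \<Rightarrow> ('a \<Rightarrow> ereal) \<Rightarrow> bool" where
  "is_solution k s p G f u \<longleftrightarrow> u \<in> W_loc s p G \<inter> L_tail s p \<and>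
     (\<forall>\<phi>\<in>Cc_infty G. energy k p (real_of_ereal \<circ> u) \<phi> \<ge> f \<phi>)"

definition is_supersolution ::
    "('a::euclidean_space \<Rightarrow> 'a \<Rightarrow> ennreal) \<Rightarrow> real \<Rightarrow> real \<Rightarrow> 'a set \<Rightarrow>
     (('a \<Rightarrow> real) \<Rightarrow> real) \<Rightarrow> ('a \<Rightarrow> ereal) \<Rightarrow> bool" where
  "is_supersolution k s p G f u \<longleftrightarrow> u \<in> W_loc s p G \<inter> L_tail s p \<and>
     (\<forall>\<phi>\<in>Cc_infty G. (\<forall>x. \<phi> x \<ge> 0) \<longrightarrow> energy k p (real_of_ereal \<circ> u) \<phi> \<ge> f \<phi>)"

definition cap_compact :: "real \<Rightarrow> real \<Rightarrow> 'a::euclidean_space set \<Rightarrow> ennreal" where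
  "cap_compact s p K =
     (INF u\<in>{u \<in> Cc_infty UNIV. \<forall>x\<in>K. u x \<ge> 1}. W_norm_pow s p UNIV u)"

definition cap_open :: "real \<Rightarrow> real \<Rightarrow> 'a::euclidean_space set \<Rightarrow> ennreal" where
  "cap_open s p G = (SUP K\<in>{K. compact K \<and> K \<subseteq> G}. cap_compact s p K)"

text \<open>
  The Sobolev capacity of an arbitrary set; on compact and on open sets it agrees with the two
  preceding definitions.
\<close>
definition sobolev_cap :: "real \<Rightarrow> real \<Rightarrow> 'a::euclidean_space set \<Rightarrow> ennreal" where
  "sobolev_cap s p E = (INF G\<in>{G. open G \<and> E \<subseteq> G}. cap_open s p G)"

end

theory Submission
  imports Defs "HOL-Computational_Algebra.Polynomial"
begin

text \<open>
  A set of zero capacity is invisible to test functions.  Let \<open>\<phi>\<close> be a test function in \<open>\<Omega>\<close>.  The part of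
  \<open>E\<close> in its support is compact and has capacity zero, so there are smooth compactly supported \<open>\<psi>\<close>,
  at least \<open>1\<close> on that part, of arbitrarily small \<open>W^{s,p}\<close> norm.  Composing \<open>\<psi>\<close> with a fixed smooth
  Lipschitz function that is \<open>1\<close> at \<open>0\<close> and vanishes from \<open>1 / 2\<close> on gives a factor \<open>\<chi> \<ge> 0\<close> which vanishes near
  that part of \<open>E\<close> and for which \<open>1 - \<chi>\<close> is as small as \<open>\<psi>\<close> (\<open>cutoff_Lipschitz\<close>).  Then \<open>\<phi> \<chi>\<close> is a test
  function in \<open>\<Omega> - E\<close>, nonnegative if \<open>\<phi>\<close> is, at which the inequality is known (\<open>Cc_infty_cutoff\<close>), and
  the error \<open>w = \<phi> (1 - \<chi>)\<close> is small in \<open>W^{s,p}\<close> (\<open>W_norm_pow_mult_le\<close>).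

  Passing to the limit takes two continuity statements.  The functional \<open>f\<close> is bounded for the norm of
  \<open>V^{s,p}(\<Omega>)\<close>, which \<open>W^{s,p}\<close> dominates.  For the energy, the kernel bound and Young's inequality give
  \<open>\<bar>\<E>(u, w)\<bar> \<le> 2 \<Lambda> (\<delta> \<parallel>u\<parallel>^p + \<delta>^{1-p} \<parallel>w\<parallel>^p)\<close> with the norm of \<open>u\<close> in \<open>V^{s,p}(\<Omega>)\<close>
  (\<open>energy_product\<close>).  This is where \<open>u \<in> V^{s,p}(\<Omega> - E)\<close> is used, a global hypothesis and not only a
  local one: since zero capacity forces zero Lebesgue measure (\<open>capacity_zero_imp_null\<close>), the norms of
  \<open>u\<close> over \<open>\<Omega> - E\<close> and over \<open>\<Omega>\<close> coincide.  The same remark shows that \<open>u\<close> lies in the local Sobolev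
  space of \<open>\<Omega>\<close>.
\<close>

section \<open>Lebesgue integration on product spaces\<close>

text \<open>
  Completeness of Lebesgue measure.  It turns the almost everywhere equal Borel representatives below into
  measurability of the original sections and partial integrals.
\<close>
lemma borel_measurable_lebesgue_AE_eq:
  fixes f g :: "'a::euclidean_space \<Rightarrow> 'b::topological_space"
  assumes g: "g \<in> borel_measurable lborel" and ae: "AE x in lborel. f x = g x"
  shows "f \<in> borel_measurable lebesgue"
proof (rule measurableI)
  fix A :: "'b set" assume A: "A \<in> sets borel"
  show "f -` A \<inter> space lebesgue \<in> sets lebesgue"
  proof (rule completion.in_sets_AE)
    have "AE x in lborel. x \<in> g -` A \<longleftrightarrow> x \<in> f -` A \<inter> space lebesgue"
      using ae by eventually_elim auto
    then show "AE x in lebesgue. x \<in> g -` A \<longleftrightarrow> x \<in> f -` A \<inter> space lebesgue"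
      by (rule AE_completion)
    have "g -` A \<inter> space lborel \<in> sets lborel"
      by (rule measurable_sets[OF g A])
    then show "g -` A \<in> sets lebesgue"
      by simp
  qed auto
qed simp

text \<open>
  The completed measure on the product is not the product of the completed measures, so the product
  theorems do not apply to it as they stand.  But a Lebesgue measurable function agrees almost everywhere
  with a Borel function, almost every section of the exceptional null set is null, and hence the iterated
  integrals do not see the difference.
\<close>
theorem nn_integral_lebesgue_Tonelli:
  fixes F :: "'a::euclidean_space \<times> 'b::euclidean_space \<Rightarrow> ennreal"
  assumes "F \<in> borel_measurable lebesgue"
  shows "(\<integral>\<^sup>+x. (\<integral>\<^sup>+y. F (x, y) \<partial>lebesgue) \<partial>lebesgue) = (\<integral>\<^sup>+z. F z \<partial>lebesgue)"
    and "(\<integral>\<^sup>+y. (\<integral>\<^sup>+x. F (x, y) \<partial>lebesgue) \<partial>lebesgue) = (\<integral>\<^sup>+z. F z \<partial>lebesgue)"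
proof -
  obtain G where G: "G \<in> borel_measurable lborel" and FG: "AE z in lborel. F z = G z"
    using completion_ex_borel_measurable[OF assms] by blast
  have G': "G \<in> borel_measurable (lborel \<Otimes>\<^sub>M lborel)"
    using G by (simp add: lborel_prod)
  have FG': "AE z in lborel \<Otimes>\<^sub>M lborel. F z = G z"
    by (subst lborel_prod) (rule FG)
  have ae1: "AE x in lborel. AE y in lborel. F (x, y) = G (x, y)"
    using lborel_pair.AE_pair[OF FG'] .
  have "AE x in lborel. (\<integral>\<^sup>+y. F (x, y) \<partial>lborel) = (\<integral>\<^sup>+y. G (x, y) \<partial>lborel)"
    using ae1 by eventually_elim (rule nn_integral_cong_AE)
  then have "(\<integral>\<^sup>+x. (\<integral>\<^sup>+y. F (x, y) \<partial>lborel) \<partial>lborel) = (\<integral>\<^sup>+x. (\<integral>\<^sup>+y. G (x, y) \<partial>lborel) \<partial>lborel)"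
    by (rule nn_integral_cong_AE)
  also have "\<dots> = (\<integral>\<^sup>+z. G z \<partial>lborel)"
    using lborel.nn_integral_fst[OF G'] by (simp add: lborel_prod)
  also have "\<dots> = (\<integral>\<^sup>+z. F z \<partial>lborel)"
    by (rule nn_integral_cong_AE) (use FG in auto)
  finally show "(\<integral>\<^sup>+x. (\<integral>\<^sup>+y. F (x, y) \<partial>lebesgue) \<partial>lebesgue) = (\<integral>\<^sup>+z. F z \<partial>lebesgue)"
    by (simp add: nn_integral_completion)
  have "AE z in lborel \<Otimes>\<^sub>M lborel. F (snd z, fst z) = G (snd z, fst z)"
  proof -
    have "AE z in distr (lborel \<Otimes>\<^sub>M lborel) (lborel \<Otimes>\<^sub>M lborel) (\<lambda>(y, x). (x, y)). F z = G z"
      using FG' lborel_pair.distr_pair_swap by metis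
    then have "AE z in lborel \<Otimes>\<^sub>M lborel. F (case z of (y, x) \<Rightarrow> (x, y)) = G (case z of (y, x) \<Rightarrow> (x, y))"
      by (rule AE_distrD[rotated]) simp
    then show ?thesis
      by (simp add: case_prod_beta)
  qed
  from lborel_pair.AE_pair[OF this]
  have ae2: "AE y in lborel. AE x in lborel. F (x, y) = G (x, y)"
    by simp
  have "AE y in lborel. (\<integral>\<^sup>+x. F (x, y) \<partial>lborel) = (\<integral>\<^sup>+x. G (x, y) \<partial>lborel)"
    using ae2 by eventually_elim (rule nn_integral_cong_AE)
  then have "(\<integral>\<^sup>+y. (\<integral>\<^sup>+x. F (x, y) \<partial>lborel) \<partial>lborel) = (\<integral>\<^sup>+y. (\<integral>\<^sup>+x. G (x, y) \<partial>lborel) \<partial>lborel)"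
    by (rule nn_integral_cong_AE)
  also have "\<dots> = (\<integral>\<^sup>+z. G z \<partial>lborel)"
    using lborel_pair.nn_integral_snd[of G] G' by (simp add: lborel_prod)
  also have "\<dots> = (\<integral>\<^sup>+z. F z \<partial>lborel)"
    by (rule nn_integral_cong_AE) (use FG in auto)
  finally show "(\<integral>\<^sup>+y. (\<integral>\<^sup>+x. F (x, y) \<partial>lebesgue) \<partial>lebesgue) = (\<integral>\<^sup>+z. F z \<partial>lebesgue)"
    by (simp add: nn_integral_completion)
qed

theorem integral_lebesgue_Fubini:
  fixes F :: "'a::euclidean_space \<times> 'b::euclidean_space \<Rightarrow> real"
  assumes F: "integrable lebesgue F"
  shows "(LINT x|lebesgue. (LINT y|lebesgue. F (x, y))) = (LINT z|lebesgue. F z)"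
proof -
  obtain G where G: "G \<in> borel_measurable lborel" and FG: "AE z in lborel. F z = G z"
    using completion_ex_borel_measurable_real borel_measurable_integrable[OF F] by blast
  have FGl: "AE z in lebesgue. F z = G z"
    using FG by (rule AE_completion)
  have "integrable lebesgue G"
    using integrable_cong_AE_imp[OF F measurable_completion[OF G]] FGl by simp
  then have Gi: "integrable (lborel \<Otimes>\<^sub>M lborel) G"
    using G by (simp add: integrable_completion lborel_prod)
  then have Gm: "G \<in> borel_measurable (lborel \<Otimes>\<^sub>M lborel)"
    by (rule borel_measurable_integrable)
  have FG': "AE z in lborel \<Otimes>\<^sub>M lborel. F z = G z"
    by (subst lborel_prod) (rule FG)
  have Gy: "(\<lambda>y. G (x, y)) \<in> borel_measurable lborel" for x
    using Gm by simp
  have Gx: "(\<lambda>x. LINT y|lborel. G (x, y)) \<in> borel_measurable lborel"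
    using Gm by (intro lborel.borel_measurable_lebesgue_integral) simp
  have eq: "AE x in lborel. (LINT y|lebesgue. F (x, y)) = (LINT y|lborel. G (x, y))"
    using lborel_pair.AE_pair[OF FG']
  proof eventually_elim
    case (elim x)
    have "(LINT y|lebesgue. F (x, y)) = (LINT y|lebesgue. G (x, y))"
      by (rule integral_cong_AE)
        (use elim borel_measurable_lebesgue_AE_eq[OF Gy elim] Gy
          in \<open>auto intro: measurable_completion AE_completion\<close>)
    then show ?case
      using Gy by (simp add: integral_completion)
  qed
  have "(LINT x|lebesgue. (LINT y|lebesgue. F (x, y))) = (LINT x|lebesgue. (LINT y|lborel. G (x, y)))"
    by (rule integral_cong_AE)
      (use borel_measurable_lebesgue_AE_eq[OF Gx eq] Gx AE_completion[OF eq]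
        in \<open>auto intro: measurable_completion\<close>)
  also have "\<dots> = (LINT x|lborel. (LINT y|lborel. G (x, y)))"
    using Gx by (simp add: integral_completion)
  also have "\<dots> = (LINT z|lborel. G z)"
    using lborel_pair.integral_fst'[OF Gi] by (simp add: lborel_prod)
  also have "\<dots> = (LINT z|lebesgue. G z)"
    using G by (simp add: integral_completion)
  also have "\<dots> = (LINT z|lebesgue. F z)"
    by (rule integral_cong_AE) (use F FGl G in \<open>auto intro: measurable_completion\<close>)
  finally show ?thesis .
qed

text \<open>
  Preimages of null sets under the projections are null; this lifts Lebesgue measurable functions of one
  variable to Lebesgue measurable functions on the product.
\<close>
lemma measurable_fst_snd_lebesgue:
  shows "fst \<in> (lebesgue :: ('a::euclidean_space \<times> 'b::euclidean_space) measure) \<rightarrow>\<^sub>M lebesgue"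
    and "snd \<in> (lebesgue :: ('a::euclidean_space \<times> 'b::euclidean_space) measure) \<rightarrow>\<^sub>M lebesgue"
proof -
  let ?L = "lebesgue :: ('a \<times> 'b) measure"
  have m: "fst \<in> ?L \<rightarrow>\<^sub>M lborel" "snd \<in> ?L \<rightarrow>\<^sub>M lborel"
    by (auto intro!: measurable_completion simp: borel_prod[symmetric])
  have prod: "emeasure ?L (A \<times> B) = emeasure lborel A * emeasure lborel B"
    if "A \<in> sets borel" "B \<in> sets borel" for A B
  proof -
    have "A \<times> B \<in> sets borel"
      using that by (rule borel_Times)
    then have "emeasure ?L (A \<times> B) = emeasure (lborel \<Otimes>\<^sub>M lborel) (A \<times> B)"
      by (simp add: lborel_prod)
    also have "\<dots> = emeasure lborel A * emeasure lborel B"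
      using that by (simp add: lborel.emeasure_pair_measure_Times)
    finally show ?thesis .
  qed
  show "fst \<in> ?L \<rightarrow>\<^sub>M lebesgue"
  proof (rule completion.measurable_completion2[OF m(1)], rule subsetI)
    fix N :: "'a set" assume N: "N \<in> null_sets lborel"
    have "fst -` N = N \<times> (UNIV :: 'b set)" by auto
    then show "N \<in> null_sets (distr ?L lborel fst)"
      using N m prod[of N UNIV] by (auto simp: null_sets_def emeasure_distr)
  qed
  show "snd \<in> ?L \<rightarrow>\<^sub>M lebesgue"
  proof (rule completion.measurable_completion2[OF m(2)], rule subsetI)
    fix N :: "'b set" assume N: "N \<in> null_sets lborel"
    have "snd -` N = (UNIV :: 'a set) \<times> N" by auto
    then show "N \<in> null_sets (distr ?L lborel snd)"
      using N m prod[of UNIV N] by (auto simp: null_sets_def emeasure_distr)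
  qed
qed

section \<open>Smooth functions and a smooth cutoff\<close>

lemma C_k_Suc_imp: "C_k (Suc m) \<phi> \<Longrightarrow> C_k m \<phi>"
proof (induction m arbitrary: \<phi>)
  case 0
  then show ?case by (simp add: differentiable_imp_continuous_on)
next
  case (Suc m)
  then show ?case by (metis C_k.simps(2))
qed

lemma C_k_const: "C_k m (\<lambda>x. c)"
proof (induction m arbitrary: c)
  case (Suc m)
  then show ?case
    by (auto simp: differentiable_on_def frechet_derivative_const)
qed simp

lemma C_k_SucI:
  assumes "\<And>x. (\<phi> has_derivative D x) (at x)" and "\<And>v. C_k m (\<lambda>x. D x v)"
  shows "C_k (Suc m) \<phi>"
proof -
  have "frechet_derivative \<phi> (at x) = D x" for x
    using frechet_derivative_at[OF assms(1)[of x]] by simp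
  moreover have "\<phi> differentiable_on UNIV"
    using assms(1) by (auto simp: differentiable_on_def differentiable_def)
  ultimately show ?thesis
    using assms(2) by simp
qed

lemma C_k_SucD:
  assumes "C_k (Suc m) \<phi>"
  shows "\<exists>D. (\<forall>x. (\<phi> has_derivative D x) (at x)) \<and> (\<forall>v. C_k m (\<lambda>x. D x v))"
  using assms
  by (auto simp: differentiable_on_def frechet_derivative_works
      intro!: exI[of _ "\<lambda>x. frechet_derivative \<phi> (at x)"])

lemma C_k_add: "C_k m a \<Longrightarrow> C_k m b \<Longrightarrow> C_k m (\<lambda>x. a x + b x)"
proof (induction m arbitrary: a b)
  case 0
  then show ?case by (auto intro: continuous_intros)
next
  case (Suc m)
  from Suc.prems(1) obtain A where A: "\<And>x. (a has_derivative A x) (at x)" "\<And>v. C_k m (\<lambda>x. A x v)"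
    by (metis C_k_SucD)
  from Suc.prems(2) obtain B where B: "\<And>x. (b has_derivative B x) (at x)" "\<And>v. C_k m (\<lambda>x. B x v)"
    by (metis C_k_SucD)
  show ?case
    by (rule C_k_SucI[where D = "\<lambda>x v. A x v + B x v"])
      (use A B in \<open>auto intro: has_derivative_add Suc.IH\<close>)
qed

lemma C_k_mult: "C_k m a \<Longrightarrow> C_k m b \<Longrightarrow> C_k m (\<lambda>x. a x * b x)"
proof (induction m arbitrary: a b)
  case 0
  then show ?case by (auto intro: continuous_intros)
next
  case (Suc m)
  from Suc.prems(1) obtain A where A: "\<And>x. (a has_derivative A x) (at x)" "\<And>v. C_k m (\<lambda>x. A x v)"
    by (metis C_k_SucD)
  from Suc.prems(2) obtain B where B: "\<And>x. (b has_derivative B x) (at x)" "\<And>v. C_k m (\<lambda>x. B x v)"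
    by (metis C_k_SucD)
  show ?case
    by (rule C_k_SucI[where D = "\<lambda>x v. a x * B x v + A x v * b x"])
      (use A B C_k_Suc_imp[OF Suc.prems(1)] C_k_Suc_imp[OF Suc.prems(2)]
        in \<open>auto intro!: has_derivative_mult C_k_add Suc.IH\<close>)
qed

text \<open>
  The functions \<open>P(1/t) exp(-1/t)\<close>, extended by \<open>0\<close> to \<open>t \<le> 0\<close>.  All polynomials are admitted because the
  class is then closed under differentiation, which is how smoothness is proved: \<open>flat_exp P\<close> has derivative
  \<open>flat_exp (x^2 (P - P'))\<close> everywhere, the origin included.
\<close>
definition flat_exp :: "real poly \<Rightarrow> real \<Rightarrow> real" where
  "flat_exp P t = (if 0 < t then poly P (1 / t) * exp (- (1 / t)) else 0)"

lemma flat_exp_tendsto_0: "((\<lambda>t. poly P (1 / t) * exp (- (1 / t))) \<longlongrightarrow> (0::real)) (at_right 0)"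
proof -
  have "((\<lambda>z. poly P z * exp (- z)) \<longlongrightarrow> (0::real)) at_top"
  proof -
    have "((\<lambda>z. \<Sum>i\<le>degree P. coeff P i * (z ^ i / exp z)) \<longlongrightarrow> (\<Sum>i\<le>degree P. coeff P i * (0::real))) at_top"
      by (intro tendsto_sum tendsto_mult tendsto_const tendsto_power_div_exp_0)
    then show ?thesis
      by (simp add: poly_altdef sum_distrib_right exp_minus divide_inverse mult.assoc)
  qed
  from filterlim_compose[OF this filterlim_inverse_at_top_right]
  show ?thesis by (simp add: inverse_eq_divide)
qed

lemma flat_exp_has_derivative:
  "(flat_exp P has_real_derivative flat_exp ([:0, 0, 1:] * (P - pderiv P)) t) (at t)"
proof (cases t "0::real" rule: linorder_cases)
  case greater
  have "((\<lambda>t. poly P (1 / t) * exp (- (1 / t))) has_real_derivative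
      flat_exp ([:0, 0, 1:] * (P - pderiv P)) t) (at t)"
    using greater
    by (auto intro!: derivative_eq_intros simp: flat_exp_def field_simps power2_eq_square)
  then show ?thesis
  proof (rule has_field_derivative_transform_within_open)
    show "open {0::real<..}" "t \<in> {0<..}" using greater by auto
  qed (simp add: flat_exp_def)
next
  case less
  have "((\<lambda>t. 0) has_real_derivative 0) (at t)" by simp
  then have "(flat_exp P has_real_derivative 0) (at t)"
  proof (rule has_field_derivative_transform_within_open)
    show "open {..<0::real}" "t \<in> {..<0}" using less by auto
  qed (simp add: flat_exp_def)
  then show ?thesis using less by (simp add: flat_exp_def)
next
  case equal
  have "((\<lambda>h. (flat_exp P h - flat_exp P 0) / (h - 0)) \<longlongrightarrow> 0) (at 0)"
  proof (rule filterlim_split_at)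
    have "\<forall>\<^sub>F h in at_right 0. poly (pCons 0 P) (1 / h) * exp (- (1 / h))
        = (flat_exp P h - flat_exp P 0) / (h - 0)"
      by (auto simp: eventually_at_filter flat_exp_def)
    from Lim_transform_eventually[OF flat_exp_tendsto_0 this] show "((\<lambda>h. (flat_exp P h - flat_exp P 0) / (h - 0)) \<longlongrightarrow> 0) (at_right 0)" .
    have "\<forall>\<^sub>F h in at_left 0. 0 = (flat_exp P h - flat_exp P 0) / (h - 0)"
      by (auto simp: eventually_at_filter flat_exp_def)
    from Lim_transform_eventually[OF tendsto_const this]
    show "((\<lambda>h. (flat_exp P h - flat_exp P 0) / (h - 0)) \<longlongrightarrow> 0) (at_left 0)" .
  qed
  then show ?thesis
    using equal by (simp add: has_field_derivative_iff flat_exp_def)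
qed

text \<open>
  Normalised so that \<open>cutoff 0 = 1\<close>.  It vanishes from \<open>1 / 2\<close> on, so that \<open>cutoff \<circ> \<psi>\<close> is zero in a
  neighbourhood of every point at which a continuous \<open>\<psi>\<close> is at least \<open>1\<close>; and it is Lipschitz, so that
  \<open>1 - cutoff \<circ> \<psi>\<close> is controlled by \<open>\<psi>\<close> in the Sobolev norm.
\<close>
definition cutoff :: "real \<Rightarrow> real" where
  "cutoff t = exp 2 * flat_exp 1 (1 / 2 - t)"

lemma cutoff_nonneg: "0 \<le> cutoff t"
  by (simp add: cutoff_def flat_exp_def)

lemma cutoff_0: "cutoff 0 = 1"
  by (simp add: cutoff_def flat_exp_def exp_minus)

lemma cutoff_eq_0: "1 / 2 \<le> t \<Longrightarrow> cutoff t = 0"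
  by (simp add: cutoff_def flat_exp_def)

lemma C_k_flat_exp_comp: "C_k m \<psi> \<Longrightarrow> C_k m (\<lambda>x. flat_exp P (c - \<psi> x))"
proof (induction m arbitrary: P)
  case 0
  have "continuous_on UNIV (flat_exp P)"
    using flat_exp_has_derivative by (meson DERIV_continuous_on has_field_derivative_at_within)
  then have "continuous_on UNIV (\<lambda>x. flat_exp P (c - \<psi> x))"
    by (rule continuous_on_compose2) (use 0 in \<open>auto intro!: continuous_intros\<close>)
  then show ?case by simp
next
  case (Suc m)
  obtain D where D: "\<And>x. (\<psi> has_derivative D x) (at x)" "\<And>v. C_k m (\<lambda>x. D x v)"
    using Suc.prems by (metis C_k_SucD)
  let ?Q = "[:0, 0, 1:] * (P - pderiv P)"
  show ?case
  proof (rule C_k_SucI[where D = "\<lambda>x v. (- 1) * (flat_exp ?Q (c - \<psi> x) * D x v)"])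
    fix x
    have "((\<lambda>x. c - \<psi> x) has_derivative (\<lambda>v. - D x v)) (at x)"
      using D(1)[of x] by (auto intro!: derivative_eq_intros)
    from has_derivative_compose[OF this flat_exp_has_derivative[of P "c - \<psi> x", unfolded has_field_derivative_def]]
    show "((\<lambda>x. flat_exp P (c - \<psi> x)) has_derivative
        (\<lambda>v. (- 1) * (flat_exp ?Q (c - \<psi> x) * D x v))) (at x)"
      by (simp del: mult_pCons_left)
  next
    fix v
    show "C_k m (\<lambda>x. (- 1) * (flat_exp ?Q (c - \<psi> x) * D x v))"
      by (intro C_k_mult C_k_const Suc.IH C_k_Suc_imp[OF Suc.prems] D(2))
  qed
qed

lemma C_k_cutoff_comp: "C_k m \<psi> \<Longrightarrow> C_k m (\<lambda>x. cutoff (\<psi> x))"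
  unfolding cutoff_def by (intro C_k_mult C_k_const C_k_flat_exp_comp)

text \<open>
  Up to the factor \<open>exp 2\<close> the derivative has modulus \<open>z\<^sup>2 exp (-z)\<close> with \<open>z = 1 / (1 / 2 - t)\<close>, and
  \<open>z\<^sup>2 \<le> 2 exp z\<close> by the exponential series.
\<close>
lemma cutoff_Lipschitz: "\<bar>cutoff a - cutoff b\<bar> \<le> 2 * exp 2 * \<bar>a - b\<bar>"
proof -
  have bd: "norm (flat_exp ([:0, 0, 1:] * (1 - pderiv 1)) t) \<le> 2" for t
  proof (cases "0 < t")
    case True
    define z where "z = 1 / t"
    have "z\<^sup>2 \<le> 2 * exp z"
    proof -
      have "0 \<le> z" using True by (simp add: z_def)
      then show ?thesis using exp_lower_Taylor_quadratic[of z] by simp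
    qed
    then have "z\<^sup>2 * exp (- z) \<le> 2"
      by (simp add: exp_minus field_simps)
    then show ?thesis
      using True by (simp add: flat_exp_def z_def power2_eq_square)
  qed (simp add: flat_exp_def)
  have "norm (flat_exp 1 (1 / 2 - a) - flat_exp 1 (1 / 2 - b)) \<le> 2 * norm ((1 / 2 - a) - (1 / 2 - b))"
    by (rule field_differentiable_bound[where S = UNIV])
      (use flat_exp_has_derivative bd in \<open>auto simp del: mult_pCons_left\<close>)
  then have "exp 2 * \<bar>flat_exp 1 (1 / 2 - a) - flat_exp 1 (1 / 2 - b)\<bar> \<le> exp 2 * (2 * \<bar>a - b\<bar>)"
    by (intro mult_left_mono) (auto simp: abs_minus_commute)
  then show ?thesis
    by (simp add: cutoff_def abs_mult right_diff_distrib[symmetric])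
qed

text \<open>
  The partial derivatives are continuous and vanish outside the compact support, hence are bounded.
\<close>
lemma Cc_infty_Lipschitz_bounded:
  fixes \<phi> :: "'a::euclidean_space \<Rightarrow> real"
  assumes "\<phi> \<in> Cc_infty G"
  obtains L where "L > 0" "\<And>x y. \<bar>\<phi> x - \<phi> y\<bar> \<le> L * norm (x - y)" "\<And>x. \<bar>\<phi> x\<bar> \<le> L"
proof -
  define S where "S = closure {x. \<phi> x \<noteq> 0}"
  have S: "compact S" "closed S"
    using assms by (auto simp: Cc_infty_def S_def)
  have zero: "\<phi> x = 0" if "x \<notin> S" for x
    using that closure_subset[of "{x. \<phi> x \<noteq> 0}"] by (auto simp: Cc_infty_def S_def)
  have "C_k (Suc 0) \<phi>"
    using assms by (auto simp: Cc_infty_def)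
  then obtain D where D: "\<And>x. (\<phi> has_derivative D x) (at x)" and cD: "\<And>v. C_k 0 (\<lambda>x. D x v)"
    by (metis C_k_SucD)
  have cphi: "continuous_on UNIV \<phi>"
    using D by (meson continuous_at_imp_continuous_on has_derivative_continuous)
  have bdd: "\<exists>B. \<forall>x. \<bar>g x\<bar> \<le> B" if "continuous_on UNIV g" "\<And>x. x \<notin> S \<Longrightarrow> g x = 0" for g :: "'a \<Rightarrow> real"
  proof -
    have "compact (g ` S)"
      using S(1) that(1) by (meson compact_continuous_image continuous_on_subset subset_UNIV)
    then obtain B where "\<forall>y\<in>g ` S. norm y \<le> B"
      using compact_imp_bounded bounded_iff by metis
    then have "\<bar>g x\<bar> \<le> max B 0" for x
      using that(2)[of x] by (cases "x \<in> S") (auto simp: le_max_iff_disj)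
    then show ?thesis by blast
  qed
  obtain B0 where B0: "\<And>x. \<bar>\<phi> x\<bar> \<le> B0"
    using bdd[OF cphi zero] by blast
  have D0: "D x v = 0" if "x \<notin> S" for x v
  proof -
    have "((\<lambda>x. 0) has_derivative (\<lambda>v. 0)) (at x)" by simp
    then have "(\<phi> has_derivative (\<lambda>v. 0)) (at x)"
      by (rule has_derivative_transform_within_open[where s = "- S"])
        (use S(2) that zero in auto)
    then show ?thesis
      using has_derivative_unique[OF D] by metis
  qed
  have "\<exists>B. \<forall>x. \<bar>D x b\<bar> \<le> B" for b
    by (rule bdd) (use cD[of b] D0 in auto)
  then obtain B where B: "\<And>x b. \<bar>D x b\<bar> \<le> B b"
    by metis
  define M where "M = (\<Sum>b\<in>Basis. B b)"
  have onorm: "onorm (D x) \<le> M" for x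
  proof (rule onorm_le)
    fix v :: 'a
    interpret bounded_linear "D x" using D has_derivative_bounded_linear by blast
    have "D x v = D x (\<Sum>b\<in>Basis. (v \<bullet> b) *\<^sub>R b)"
      by (simp add: euclidean_representation)
    also have "\<dots> = (\<Sum>b\<in>Basis. (v \<bullet> b) * D x b)"
      by (simp add: sum scaleR)
    finally have "norm (D x v) \<le> (\<Sum>b\<in>Basis. norm ((v \<bullet> b) * D x b))"
      by (simp add: norm_sum del: real_norm_def)
    also have "\<dots> \<le> (\<Sum>b\<in>Basis. norm v * B b)"
      by (intro sum_mono) (auto simp: abs_mult intro!: mult_mono Basis_le_norm B)
    finally show "norm (D x v) \<le> M * norm v"
      by (simp add: M_def sum_distrib_left mult.commute)
  qed
  define L where "L = max 1 (max M B0)"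
  have "\<bar>\<phi> x - \<phi> y\<bar> \<le> L * norm (x - y)" for x y
  proof -
    have "norm (\<phi> x - \<phi> y) \<le> M * norm (x - y)"
      by (rule differentiable_bound[where S = UNIV and f' = D]) (use D onorm in auto)
    also have "\<dots> \<le> L * norm (x - y)"
      by (intro mult_right_mono) (auto simp: L_def)
    finally show ?thesis by simp
  qed
  moreover have "\<bar>\<phi> x\<bar> \<le> L" for x
    using B0[of x] by (simp add: L_def)
  ultimately show thesis
    by (intro that[of L]) (auto simp: L_def)
qed

lemma Cc_infty_measurable: "\<phi> \<in> Cc_infty G \<Longrightarrow> \<phi> \<in> borel_measurable lebesgue"
proof -
  assume "\<phi> \<in> Cc_infty G"
  then have "C_k 0 \<phi>"
    unfolding Cc_infty_def by blast
  then show ?thesis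
    by (auto intro!: measurable_completion borel_measurable_continuous_onI)
qed

section \<open>The kernel integral of test functions\<close>

lemma ex_dyadic_powr:
  assumes "1 \<le> (x::real)"
  obtains i :: nat where "2 powr real i \<le> x" "x < 2 powr (real i + 1)"
proof -
  define i where "i = nat \<lfloor>log 2 x\<rfloor>"
  have "real i \<le> log 2 x" "log 2 x < real i + 1"
    using assms by (auto simp: i_def of_nat_floor)
  then show thesis
    using assms by (intro that[of i]) (auto simp: le_log_iff log_less_iff)
qed

text \<open>
  A dyadic decomposition.  On the shell where \<open>norm z\<close> is about \<open>2^i\<close> the integrand is about
  \<open>2^(- i (n + s p))\<close> and the measure of the shell about \<open>2^(i n)\<close>, so the shells with \<open>norm z \<ge> 1\<close>
  contribute a geometric series of ratio \<open>2^(- s p)\<close>.  Where \<open>norm z\<close> is about \<open>2^(- i)\<close> the truncation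
  gives the additional factor \<open>2^(- i p)\<close>, and the ratio becomes \<open>2^(- p (1 - s))\<close>.  Both ratios are less
  than \<open>1\<close> because \<open>0 < s < 1\<close>.
\<close>
lemma nn_integral_truncated_power_finite:
  fixes s p :: real
  assumes "0 < s" "s < 1" "0 < p"
  shows "(\<integral>\<^sup>+z.
      ennreal (min 1 (norm (z::'a::euclidean_space)) powr p / norm z powr (real DIM('a) + s * p)) \<partial>lborel) < \<infinity>"
proof -
  define n where "n = real DIM('a)"
  define N where "N = n + s * p"
  have N: "0 < N" "0 < n"
    using assms by (auto simp: N_def n_def intro!: add_pos_nonneg)
  define c where "c = emeasure lborel (ball (0::'a) 1)"
  have c: "c < \<infinity>"
    unfolding c_def by (rule emeasure_lborel_ball_finite)
  have ball: "emeasure lborel (ball (0::'a) (2 powr t)) = ennreal (2 powr (t * n)) * c" for t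
    using emeasure_lebesgue_ball_conv_unit_ball[of "2 powr t" "0::'a"]
    by (simp add: c_def n_def powr_powr powr_realpow[symmetric])
  \<comment> \<open>Balls in place of shells: the bound at scale \<open>i\<close> is needed on the shell only, but a ball
    containing the shell has a known measure of the same order.\<close>
  define far where "far i z = ennreal (2 powr (- real i * N)) *
      indicator (ball (0::'a) (2 powr (real i + 1))) z" for i :: nat and z
  define near where "near i z = ennreal (2 powr (- real i * p + (real i + 1) * N)) *
      indicator (ball (0::'a) (2 powr (1 - real i))) z" for i :: nat and z
  have [measurable]: "(\<lambda>z. far i z) \<in> borel_measurable lborel"
    "(\<lambda>z. near i z) \<in> borel_measurable lborel" for i
    unfolding far_def near_def
    by (intro borel_measurable_times_ennreal borel_measurable_const borel_measurable_indicator,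
        simp only: sets_lborel, intro borel_open open_ball)+
  have bound: "ennreal (min 1 (norm z) powr p / norm z powr N) \<le> (\<Sum>i. far i z) + (\<Sum>i. near i z)"
    for z :: 'a
  proof (cases "z = 0")
    case False
    show ?thesis
    proof (cases "1 \<le> norm z")
      case True
      then obtain i :: nat where r: "2 powr real i \<le> norm z" "norm z < 2 powr (real i + 1)"
        by (rule ex_dyadic_powr)
      have "norm z powr (- N) \<le> (2 powr real i) powr (- N)"
        using N r(1) by (intro powr_mono2') auto
      then have "min 1 (norm z) powr p / norm z powr N \<le> 2 powr (- real i * N)"
        using True by (simp add: powr_powr powr_minus_divide)
      then have "ennreal (min 1 (norm z) powr p / norm z powr N) \<le> far i z"
        using r by (simp add: far_def ennreal_leI)
      also have "\<dots> \<le> (\<Sum>i. far i z)"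
        using sum_le_suminf[of "\<lambda>i. far i z" "{i}"] by simp
      finally show ?thesis
        by (simp add: add_increasing2)
    next
      case near: False
      with \<open>z \<noteq> 0\<close> have "1 \<le> 1 / norm z" by simp
      then obtain i :: nat where i': "2 powr real i \<le> 1 / norm z" "1 / norm z < 2 powr (real i + 1)"
        by (rule ex_dyadic_powr)
      have "1 / (2 powr (real i + 1)) < norm z" "norm z \<le> 1 / 2 powr real i"
        using i' \<open>z \<noteq> 0\<close> by (auto simp: field_simps)
      then have r: "2 powr - (real i + 1) < norm z" "norm z \<le> 2 powr - real i"
        unfolding powr_minus_divide by auto
      have "norm z powr (- N) \<le> (2 powr - (real i + 1)) powr (- N)"
        using N r(1) by (intro powr_mono2') auto
      then have 1: "norm z powr (- N) \<le> 2 powr ((real i + 1) * N)"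
        unfolding powr_powr by (simp add: algebra_simps)
      have "norm z powr p \<le> (2 powr - real i) powr p"
        using r(2) assms by (intro powr_mono2) auto
      then have 2: "norm z powr p \<le> 2 powr (- real i * p)"
        by (simp add: powr_powr)
      have "norm z powr p * norm z powr (- N) \<le> 2 powr (- real i * p) * 2 powr ((real i + 1) * N)"
        using 1 2 by (intro mult_mono) auto
      then have le: "min 1 (norm z) powr p / norm z powr N \<le> 2 powr (- real i * p + (real i + 1) * N)"
        using near by (simp add: powr_minus_divide powr_add powr_diff)
      have "norm z < 2 powr (1 - real i)"
        using r(2) by (rule le_less_trans) simp
      then have "ennreal (min 1 (norm z) powr p / norm z powr N) \<le> near i z"
        using le by (simp add: near_def ennreal_leI)
      also have "\<dots> \<le> (\<Sum>i. near i z)"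
        using sum_le_suminf[of "\<lambda>i. near i z" "{i}"] by simp
      finally show ?thesis
        by (simp add: add_increasing)
    qed
  qed simp
  have geom: "(\<Sum>i. ennreal (C * (2 powr - t) ^ i) * c) < \<infinity>" if "0 < t" "0 \<le> C" for C t :: real
  proof -
    have "summable (\<lambda>i. C * (2 powr - t) ^ i)"
      using that powr_less_mono[of "- t" 0 2] by (intro summable_mult summable_geometric) simp
    then have "(\<Sum>i. ennreal (C * (2 powr - t) ^ i)) \<noteq> top"
      using that by (intro ennreal_suminf_neq_top) auto
    then show ?thesis
      using c by (simp add: ennreal_mult_eq_top_iff less_top[symmetric])
  qed
  have far_eq: "(\<integral>\<^sup>+z. far i z \<partial>lborel) = ennreal (2 powr n * (2 powr - (s * p)) ^ i) * c" for i
  proof -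
    have "2 powr (- real i * N) * 2 powr ((real i + 1) * n) = 2 powr n * (2 powr - (s * p)) ^ i"
      by (simp add: powr_realpow[symmetric] powr_powr powr_add[symmetric] N_def algebra_simps)
    then show ?thesis
      unfolding far_def
      by (subst nn_integral_cmult_indicator)
        (auto simp: ball mult.assoc[symmetric] ennreal_mult[symmetric])
  qed
  have far: "(\<Sum>i. \<integral>\<^sup>+z. far i z \<partial>lborel) < \<infinity>"
    unfolding far_eq by (rule geom) (use assms in auto)
  have near_eq: "(\<integral>\<^sup>+z. near i z \<partial>lborel) = ennreal (2 powr (n + N) * (2 powr - (p * (1 - s))) ^ i) * c" for i
  proof -
    have "2 powr (- real i * p + (real i + 1) * N) * 2 powr ((1 - real i) * n)
        = 2 powr (n + N) * (2 powr - (p * (1 - s))) ^ i"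
      by (simp add: powr_realpow[symmetric] powr_powr powr_add[symmetric] N_def algebra_simps)
    then show ?thesis
      unfolding near_def
      by (subst nn_integral_cmult_indicator)
        (auto simp: ball mult.assoc[symmetric] ennreal_mult[symmetric])
  qed
  have near: "(\<Sum>i. \<integral>\<^sup>+z. near i z \<partial>lborel) < \<infinity>"
    unfolding near_eq by (rule geom) (use assms in auto)
  have "(\<integral>\<^sup>+z. ennreal (min 1 (norm (z::'a)) powr p / norm z powr N) \<partial>lborel)
      \<le> (\<integral>\<^sup>+z. (\<Sum>i. far i z) + (\<Sum>i. near i z) \<partial>lborel)"
    by (rule nn_integral_mono) (rule bound)
  also have "\<dots> = (\<Sum>i. \<integral>\<^sup>+z. far i z \<partial>lborel) + (\<Sum>i. \<integral>\<^sup>+z. near i z \<partial>lborel)"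
    by (simp add: nn_integral_add nn_integral_suminf)
  also have "\<dots> < \<infinity>"
    unfolding infinity_ennreal_def using far near by (subst ennreal_add_less_top) auto
  finally show ?thesis
    by (simp add: N_def n_def)
qed

text \<open>
  A test function satisfies \<open>\<bar>\<phi> x - \<phi> y\<bar> \<le> 2 L min 1 (norm (x - y))\<close>, which bounds the inner Gagliardo
  integral uniformly in \<open>y\<close> by a translate of the preceding integral.
\<close>
lemma Gagliardo_slice_bound:
  fixes \<phi> :: "'a::euclidean_space \<Rightarrow> real" and s p :: real
  assumes sp: "0 < s" "s < 1" "0 < p"
    and \<phi>: "\<phi> \<in> Cc_infty G"
  obtains M where "M < \<infinity>"
    "\<And>y. (\<integral>\<^sup>+x. ennreal (\<bar>\<phi> x - \<phi> y\<bar> powr p / norm (x - y) powr (real DIM('a) + s * p)) \<partial>lebesgue) \<le> M"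
proof -
  let ?h = "\<lambda>z::'a. ennreal (min 1 (norm z) powr p / norm z powr (real DIM('a) + s * p))"
  obtain L where L: "L > 0" "\<And>x y. \<bar>\<phi> x - \<phi> y\<bar> \<le> L * norm (x - y)" "\<And>x. \<bar>\<phi> x\<bar> \<le> L"
    using Cc_infty_Lipschitz_bounded[OF \<phi>] by metis
  define M where "M = ennreal ((2 * L) powr p) * (\<integral>\<^sup>+z. ?h z \<partial>lborel)"
  have "M < \<infinity>"
    using nn_integral_truncated_power_finite[OF sp, where 'a = 'a]
    by (auto simp: M_def ennreal_mult_less_top)
  moreover have "(\<integral>\<^sup>+x. ennreal (\<bar>\<phi> x - \<phi> y\<bar> powr p / norm (x - y) powr (real DIM('a) + s * p)) \<partial>lebesgue) \<le> M"
    for y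
  proof -
    have le: "\<bar>\<phi> x - \<phi> y\<bar> \<le> 2 * L * min 1 (norm (x - y))" for x
    proof -
      have "\<bar>\<phi> x - \<phi> y\<bar> \<le> 2 * L"
        using L(3)[of x] L(3)[of y] by linarith
      moreover have "\<bar>\<phi> x - \<phi> y\<bar> \<le> 2 * L * norm (x - y)"
        using L(1) by (intro order_trans[OF L(2)] mult_right_mono) auto
      ultimately show ?thesis
        by (simp add: min_def)
    qed
    have "\<bar>\<phi> x - \<phi> y\<bar> powr p \<le> (2 * L) powr p * min 1 (norm (x - y)) powr p" for x
    proof -
      have "\<bar>\<phi> x - \<phi> y\<bar> powr p \<le> (2 * L * min 1 (norm (x - y))) powr p"
        using le sp by (intro powr_mono2) auto
      then show ?thesis
        using L(1) by (simp add: powr_mult)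
    qed
    then have pw: "ennreal (\<bar>\<phi> x - \<phi> y\<bar> powr p / norm (x - y) powr (real DIM('a) + s * p))
        \<le> ennreal ((2 * L) powr p) * ?h (- y + x)" for x
      by (auto simp: ennreal_mult[symmetric] times_divide_eq_right intro!: ennreal_leI divide_right_mono)
    have "(\<integral>\<^sup>+x. ennreal (\<bar>\<phi> x - \<phi> y\<bar> powr p / norm (x - y) powr (real DIM('a) + s * p)) \<partial>lborel)
        \<le> (\<integral>\<^sup>+x. ennreal ((2 * L) powr p) * ?h (- y + x) \<partial>lborel)"
      by (intro nn_integral_mono pw)
    also have "\<dots> = ennreal ((2 * L) powr p) * (\<integral>\<^sup>+x. ?h (- y + x) \<partial>lborel)"
      by (rule nn_integral_cmult) measurable
    also have "(\<integral>\<^sup>+x. ?h (- y + x) \<partial>lborel) = (\<integral>\<^sup>+z. ?h z \<partial>distr lborel borel ((+) (- y)))"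
      by (subst nn_integral_distr) measurable
    also have "\<dots> = (\<integral>\<^sup>+z. ?h z \<partial>lborel)"
      by (simp only: lborel_distr_plus)
    finally show ?thesis
      by (simp add: M_def nn_integral_completion)
  qed
  ultimately show thesis
    by (rule that)
qed

section \<open>Norms as integrals over the product space\<close>

definition gagliardo :: "real \<Rightarrow> real \<Rightarrow> ('a::euclidean_space \<Rightarrow> real) \<Rightarrow> 'a \<times> 'a \<Rightarrow> real" where
  "gagliardo s p u z =
     \<bar>u (fst z) - u (snd z)\<bar> powr p / norm (fst z - snd z) powr (real DIM('a) + s * p)"

lemma gagliardo_nonneg: "0 \<le> gagliardo s p u z"
  by (simp add: gagliardo_def)

lemma gagliardo_swap: "gagliardo s p u (prod.swap z) = gagliardo s p u z"
  by (simp add: gagliardo_def abs_minus_commute norm_minus_commute)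

lemma borel_measurable_norm_diff_lebesgue:
  "(\<lambda>z. norm (fst z - snd z)) \<in> borel_measurable (lebesgue :: ('a::euclidean_space \<times> 'a) measure)"
  by (rule measurable_completion) (auto intro!: borel_measurable_continuous_onI continuous_intros)

lemma gagliardo_measurable:
  fixes u :: "'a::euclidean_space \<Rightarrow> real"
  assumes "u \<in> borel_measurable lebesgue"
  shows "gagliardo s p u \<in> borel_measurable lebesgue"
proof -
  have [measurable]: "(\<lambda>z::'a \<times> 'a. u (fst z)) \<in> borel_measurable lebesgue"
    "(\<lambda>z::'a \<times> 'a. u (snd z)) \<in> borel_measurable lebesgue"
    using measurable_compose[OF measurable_fst_snd_lebesgue(1) assms]
      measurable_compose[OF measurable_fst_snd_lebesgue(2) assms] by auto
  note [measurable] = borel_measurable_norm_diff_lebesgue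
  show ?thesis
    unfolding gagliardo_def[abs_def] by measurable
qed

lemma W_norm_pow_UNIV:
  fixes u :: "'a::euclidean_space \<Rightarrow> real"
  assumes "u \<in> borel_measurable lebesgue"
  shows "W_norm_pow s p UNIV u =
    (\<integral>\<^sup>+x. ennreal (\<bar>u x\<bar> powr p) \<partial>lebesgue) + (\<integral>\<^sup>+z. ennreal (gagliardo s p u z) \<partial>lebesgue)"
proof -
  have "(\<lambda>z. ennreal (gagliardo s p u z)) \<in> borel_measurable lebesgue"
    using gagliardo_measurable[OF assms] by measurable
  from nn_integral_lebesgue_Tonelli(1)[OF this]
  show ?thesis
    by (simp add: W_norm_pow_def gagliardo_def)
qed

text \<open>
  The inner integral of the \<open>V\<close>-norm runs over the whole space and only the outer one over \<open>G\<close>.  By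
  Tonelli and the symmetry of the integrand it does not matter which of the two variables is confined
  to \<open>G\<close>; both forms are needed because the energy integrand lives where at least one variable is in \<open>G\<close>.
\<close>
lemma V_norm_pow_product:
  fixes u :: "'a::euclidean_space \<Rightarrow> real"
  assumes u: "u \<in> borel_measurable lebesgue" and G: "G \<in> sets lebesgue"
  shows "V_norm_pow s p G u = (\<integral>\<^sup>+x\<in>G. ennreal (\<bar>u x\<bar> powr p) \<partial>lebesgue) +
      (\<integral>\<^sup>+z\<in>G \<times> UNIV. ennreal (gagliardo s p u z) \<partial>lebesgue)"
    and "V_norm_pow s p G u = (\<integral>\<^sup>+x\<in>G. ennreal (\<bar>u x\<bar> powr p) \<partial>lebesgue) +
      (\<integral>\<^sup>+z\<in>UNIV \<times> G. ennreal (gagliardo s p u z) \<partial>lebesgue)"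
proof -
  have m[measurable]: "(\<lambda>z. ennreal (gagliardo s p u z)) \<in> borel_measurable lebesgue"
    using gagliardo_measurable[OF u] by measurable
  have "fst -` G \<inter> space lebesgue \<in> sets (lebesgue :: ('a \<times> 'a) measure)"
    "snd -` G \<inter> space lebesgue \<in> sets (lebesgue :: ('a \<times> 'a) measure)"
    using measurable_sets[OF measurable_fst_snd_lebesgue(1) G]
      measurable_sets[OF measurable_fst_snd_lebesgue(2) G] by auto
  moreover have "fst -` G = G \<times> (UNIV :: 'a set)" "snd -` G = (UNIV :: 'a set) \<times> G"
    by auto
  ultimately have [measurable]: "G \<times> (UNIV :: 'a set) \<in> sets lebesgue" "(UNIV :: 'a set) \<times> G \<in> sets lebesgue"
    by auto
  have "(\<integral>\<^sup>+x\<in>G. (\<integral>\<^sup>+y. ennreal (gagliardo s p u (x, y)) \<partial>lebesgue) \<partial>lebesgue)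
      = (\<integral>\<^sup>+x. (\<integral>\<^sup>+y. ennreal (gagliardo s p u (x, y)) * indicator (G \<times> UNIV) (x, y) \<partial>lebesgue) \<partial>lebesgue)"
    by (intro nn_integral_cong) (auto split: split_indicator)
  also have "\<dots> = (\<integral>\<^sup>+z\<in>G \<times> UNIV. ennreal (gagliardo s p u z) \<partial>lebesgue)"
    by (rule nn_integral_lebesgue_Tonelli(1)) measurable
  finally have 1: "(\<integral>\<^sup>+x\<in>G. (\<integral>\<^sup>+y. ennreal (gagliardo s p u (x, y)) \<partial>lebesgue) \<partial>lebesgue)
      = (\<integral>\<^sup>+z\<in>G \<times> UNIV. ennreal (gagliardo s p u z) \<partial>lebesgue)" .
  have "(\<integral>\<^sup>+x\<in>G. (\<integral>\<^sup>+y. ennreal (gagliardo s p u (x, y)) \<partial>lebesgue) \<partial>lebesgue)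
      = (\<integral>\<^sup>+x. (\<integral>\<^sup>+y. ennreal (gagliardo s p u (y, x)) * indicator (UNIV \<times> G) (y, x) \<partial>lebesgue) \<partial>lebesgue)"
    using gagliardo_swap[of s p u]
    by (intro nn_integral_cong) (auto split: split_indicator)
  also have "\<dots> = (\<integral>\<^sup>+z\<in>UNIV \<times> G. ennreal (gagliardo s p u z) \<partial>lebesgue)"
    by (rule nn_integral_lebesgue_Tonelli(2)) measurable
  finally have 2: "(\<integral>\<^sup>+x\<in>G. (\<integral>\<^sup>+y. ennreal (gagliardo s p u (x, y)) \<partial>lebesgue) \<partial>lebesgue)
      = (\<integral>\<^sup>+z\<in>UNIV \<times> G. ennreal (gagliardo s p u z) \<partial>lebesgue)" .
  show "V_norm_pow s p G u = (\<integral>\<^sup>+x\<in>G. ennreal (\<bar>u x\<bar> powr p) \<partial>lebesgue) +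
      (\<integral>\<^sup>+z\<in>G \<times> UNIV. ennreal (gagliardo s p u z) \<partial>lebesgue)"
    using 1 by (simp add: V_norm_pow_def gagliardo_def)
  show "V_norm_pow s p G u = (\<integral>\<^sup>+x\<in>G. ennreal (\<bar>u x\<bar> powr p) \<partial>lebesgue) +
      (\<integral>\<^sup>+z\<in>UNIV \<times> G. ennreal (gagliardo s p u z) \<partial>lebesgue)"
    using 2 by (simp add: V_norm_pow_def gagliardo_def)
qed

lemma V_norm_pow_le_W_norm_pow: "V_norm_pow s p G u \<le> W_norm_pow s p UNIV u"
proof -
  have "(\<integral>\<^sup>+x\<in>G. F x \<partial>lebesgue) \<le> (\<integral>\<^sup>+x. F x \<partial>lebesgue)" for F :: "'a \<Rightarrow> ennreal"
    by (intro nn_integral_mono) (auto split: split_indicator)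
  then show ?thesis
    unfolding V_norm_pow_def W_norm_pow_def by (simp add: add_mono)
qed

lemma powr_add_le:
  assumes "0 \<le> a" "0 \<le> b" "0 < (p::real)"
  shows "(a + b) powr p \<le> 2 powr p * (a powr p + b powr p)"
proof -
  have "(a + b) powr p \<le> (2 * max a b) powr p"
    using assms by (intro powr_mono2) auto
  also have "\<dots> = 2 powr p * (max a b) powr p"
    using assms by (simp add: powr_mult)
  also have "\<dots> \<le> 2 powr p * (a powr p + b powr p)"
    by (intro mult_left_mono) (auto simp: max_def)
  finally show ?thesis .
qed

text \<open>
  The quantitative form of the statement that \<open>\<phi> \<eta>\<close> is small when \<open>\<eta>\<close> is.  In
  \<open>\<phi> x \<eta> x - \<phi> y \<eta> y = \<phi> x (\<eta> x - \<eta> y) + \<eta> y (\<phi> x - \<phi> y)\<close> the first summand is bounded by the seminorm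
  of \<open>\<eta>\<close> because \<open>\<phi>\<close> is bounded, and the second, after integration in \<open>x\<close>, by \<open>\<integral> \<bar>\<eta> y\<bar>^p\<close> because of
  the uniform slice bound for \<open>\<phi>\<close>.  Here \<open>\<eta>\<close> will be \<open>1 - cutoff \<circ> \<psi>\<close>, which
  \<open>K \<psi>\<close> dominates together with its increments.  The constant is chosen before \<open>\<psi>\<close> and \<open>\<eta>\<close>,
  so that \<open>\<psi>\<close> can then be taken small relative to it.
\<close>
lemma W_norm_pow_mult_le:
  fixes \<phi> :: "'a::euclidean_space \<Rightarrow> real" and s p K :: real
  assumes sp: "0 < s" "s < 1" "0 < p" and K: "0 \<le> K"
    and \<phi>: "\<phi> \<in> Cc_infty G"
  shows "\<exists>C<\<infinity>. \<forall>\<psi>\<in>borel_measurable lebesgue. \<forall>\<eta>\<in>borel_measurable lebesgue.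
      (\<forall>x. \<bar>\<eta> x\<bar> \<le> K * \<bar>\<psi> x\<bar>) \<longrightarrow> (\<forall>x y. \<bar>\<eta> x - \<eta> y\<bar> \<le> K * \<bar>\<psi> x - \<psi> y\<bar>) \<longrightarrow>
      W_norm_pow s p UNIV (\<lambda>x. \<phi> x * \<eta> x) \<le> C * W_norm_pow s p UNIV \<psi>"
proof -
  obtain L where L: "L > 0" "\<And>x y. \<bar>\<phi> x - \<phi> y\<bar> \<le> L * norm (x - y)" "\<And>x. \<bar>\<phi> x\<bar> \<le> L"
    using Cc_infty_Lipschitz_bounded[OF \<phi>] by metis
  obtain M where M: "M < \<infinity>"
    "\<And>y. (\<integral>\<^sup>+x. ennreal (\<bar>\<phi> x - \<phi> y\<bar> powr p / norm (x - y) powr (real DIM('a) + s * p)) \<partial>lebesgue) \<le> M"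
    using Gagliardo_slice_bound[OF sp \<phi>] by metis
  have \<phi>m: "\<phi> \<in> borel_measurable lebesgue"
    using \<phi> by (rule Cc_infty_measurable)
  define A where "A = ennreal ((L * K) powr p)"
  define B where "B = ennreal (2 powr p * K powr p)"
  define C where "C = A + ennreal (2 powr p) * A + B * M"
  have "C < \<infinity>"
    using M(1) by (auto simp: C_def A_def B_def ennreal_mult_less_top)
  moreover have "W_norm_pow s p UNIV (\<lambda>x. \<phi> x * \<eta> x) \<le> C * W_norm_pow s p UNIV \<psi>"
    if \<psi>m: "\<psi> \<in> borel_measurable lebesgue" and \<eta>m: "\<eta> \<in> borel_measurable lebesgue"
      and le: "\<And>x. \<bar>\<eta> x\<bar> \<le> K * \<bar>\<psi> x\<bar>" and Lip: "\<And>x y. \<bar>\<eta> x - \<eta> y\<bar> \<le> K * \<bar>\<psi> x - \<psi> y\<bar>"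
    for \<psi> \<eta>
  proof -
    let ?I = "\<integral>\<^sup>+x. ennreal (\<bar>\<psi> x\<bar> powr p) \<partial>lebesgue"
    let ?J = "\<integral>\<^sup>+z. ennreal (gagliardo s p \<psi> z) \<partial>lebesgue"
    have Wpsi: "W_norm_pow s p UNIV \<psi> = ?I + ?J"
      by (rule W_norm_pow_UNIV[OF \<psi>m])
    note [measurable] = \<phi>m \<psi>m \<eta>m gagliardo_measurable[OF \<phi>m] gagliardo_measurable[OF \<psi>m]
    have [measurable]: "(\<lambda>z::'a \<times> 'a. \<psi> (snd z)) \<in> borel_measurable lebesgue"
      using measurable_compose[OF measurable_fst_snd_lebesgue(2) \<psi>m] .
    have "\<bar>\<phi> x * \<eta> x\<bar> powr p \<le> (L * K) powr p * \<bar>\<psi> x\<bar> powr p" for x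
    proof -
      have "\<bar>\<phi> x * \<eta> x\<bar> \<le> L * (K * \<bar>\<psi> x\<bar>)"
        unfolding abs_mult using L le by (intro mult_mono) auto
      then have "\<bar>\<phi> x * \<eta> x\<bar> powr p \<le> (L * K * \<bar>\<psi> x\<bar>) powr p"
        using sp by (intro powr_mono2) (auto simp: mult.assoc)
      then show ?thesis
        using L(1) K by (simp add: powr_mult)
    qed
    then have "(\<integral>\<^sup>+x. ennreal (\<bar>\<phi> x * \<eta> x\<bar> powr p) \<partial>lebesgue) \<le>
        (\<integral>\<^sup>+x. A * ennreal (\<bar>\<psi> x\<bar> powr p) \<partial>lebesgue)"
      by (intro nn_integral_mono) (auto simp: A_def ennreal_mult[symmetric] intro!: ennreal_leI)
    also have "\<dots> = A * ?I"
      by (rule nn_integral_cmult) measurable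
    finally have 1: "(\<integral>\<^sup>+x. ennreal (\<bar>\<phi> x * \<eta> x\<bar> powr p) \<partial>lebesgue) \<le> A * ?I" .
    have pw: "gagliardo s p (\<lambda>x. \<phi> x * \<eta> x) z \<le> 2 powr p * (L * K) powr p * gagliardo s p \<psi> z
        + 2 powr p * K powr p * (\<bar>\<psi> (snd z)\<bar> powr p * gagliardo s p \<phi> z)" for z
    proof -
      obtain x y where z: "z = (x, y)" by (cases z)
      have "\<phi> x * \<eta> x - \<phi> y * \<eta> y = \<phi> x * (\<eta> x - \<eta> y) + \<eta> y * (\<phi> x - \<phi> y)"
        by (simp add: algebra_simps)
      then have "\<bar>\<phi> x * \<eta> x - \<phi> y * \<eta> y\<bar> \<le> \<bar>\<phi> x\<bar> * \<bar>\<eta> x - \<eta> y\<bar> + \<bar>\<eta> y\<bar> * \<bar>\<phi> x - \<phi> y\<bar>"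
        by (metis abs_mult abs_triangle_ineq)
      also have "\<dots> \<le> L * (K * \<bar>\<psi> x - \<psi> y\<bar>) + (K * \<bar>\<psi> y\<bar>) * \<bar>\<phi> x - \<phi> y\<bar>"
        using L K Lip le by (intro add_mono mult_mono) auto
      finally have "\<bar>\<phi> x * \<eta> x - \<phi> y * \<eta> y\<bar> powr p
          \<le> (L * (K * \<bar>\<psi> x - \<psi> y\<bar>) + (K * \<bar>\<psi> y\<bar>) * \<bar>\<phi> x - \<phi> y\<bar>) powr p"
        using sp by (intro powr_mono2) auto
      also have "\<dots> \<le> 2 powr p * ((L * (K * \<bar>\<psi> x - \<psi> y\<bar>)) powr p + ((K * \<bar>\<psi> y\<bar>) * \<bar>\<phi> x - \<phi> y\<bar>) powr p)"
        using L(1) K sp by (intro powr_add_le) auto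
      also have "\<dots> = 2 powr p * (L * K) powr p * \<bar>\<psi> x - \<psi> y\<bar> powr p
          + 2 powr p * K powr p * (\<bar>\<psi> y\<bar> powr p * \<bar>\<phi> x - \<phi> y\<bar> powr p)"
        using L(1) K by (simp add: powr_mult algebra_simps)
      finally show ?thesis
        unfolding z gagliardo_def fst_conv snd_conv
        by (simp only: times_divide_eq_right add_divide_distrib[symmetric])
          (rule divide_right_mono, simp_all)
    qed
    have slice: "(\<integral>\<^sup>+z. ennreal (\<bar>\<psi> (snd z)\<bar> powr p) * ennreal (gagliardo s p \<phi> z) \<partial>lebesgue) \<le> M * ?I"
    proof -
      have "(\<integral>\<^sup>+z. ennreal (\<bar>\<psi> (snd z)\<bar> powr p) * ennreal (gagliardo s p \<phi> z) \<partial>lebesgue)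
          = (\<integral>\<^sup>+y. (\<integral>\<^sup>+x. ennreal (\<bar>\<psi> y\<bar> powr p) * ennreal (gagliardo s p \<phi> (x, y)) \<partial>lebesgue) \<partial>lebesgue)"
        by (subst nn_integral_lebesgue_Tonelli(2)[symmetric]) simp_all
      also have "\<dots> \<le> (\<integral>\<^sup>+y. M * ennreal (\<bar>\<psi> y\<bar> powr p) \<partial>lebesgue)"
      proof (intro nn_integral_mono)
        fix y
        have "(\<lambda>x. \<phi> x - \<phi> y) \<in> borel_measurable lebesgue" by measurable
        moreover have "(\<lambda>x. norm (x - y)) \<in> borel_measurable lebesgue"
          by (rule measurable_completion) (auto intro!: borel_measurable_continuous_onI continuous_intros)
        ultimately have "(\<lambda>x. ennreal (gagliardo s p \<phi> (x, y))) \<in> borel_measurable lebesgue"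
          unfolding gagliardo_def fst_conv snd_conv by measurable
        then have "(\<integral>\<^sup>+x. ennreal (\<bar>\<psi> y\<bar> powr p) * ennreal (gagliardo s p \<phi> (x, y)) \<partial>lebesgue)
            = ennreal (\<bar>\<psi> y\<bar> powr p) * (\<integral>\<^sup>+x. ennreal (gagliardo s p \<phi> (x, y)) \<partial>lebesgue)"
          by (rule nn_integral_cmult)
        also have "\<dots> \<le> ennreal (\<bar>\<psi> y\<bar> powr p) * M"
          using M(2)[of y] by (intro mult_left_mono) (auto simp: gagliardo_def)
        finally show "(\<integral>\<^sup>+x. ennreal (\<bar>\<psi> y\<bar> powr p) * ennreal (gagliardo s p \<phi> (x, y)) \<partial>lebesgue)
            \<le> M * ennreal (\<bar>\<psi> y\<bar> powr p)"
          by (simp add: mult.commute)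
      qed
      also have "\<dots> = M * ?I"
        by (rule nn_integral_cmult) measurable
      finally show ?thesis .
    qed
    have "(\<integral>\<^sup>+z. ennreal (gagliardo s p (\<lambda>x. \<phi> x * \<eta> x) z) \<partial>lebesgue)
        \<le> (\<integral>\<^sup>+z. ennreal (2 powr p) * A * ennreal (gagliardo s p \<psi> z)
          + B * (ennreal (\<bar>\<psi> (snd z)\<bar> powr p) * ennreal (gagliardo s p \<phi> z)) \<partial>lebesgue)"
      using pw by (intro nn_integral_mono)
        (simp add: A_def B_def ennreal_mult[symmetric] ennreal_plus[symmetric] gagliardo_nonneg
          ennreal_leI del: ennreal_plus)
    also have "\<dots> = ennreal (2 powr p) * A * ?J
        + B * (\<integral>\<^sup>+z. ennreal (\<bar>\<psi> (snd z)\<bar> powr p) * ennreal (gagliardo s p \<phi> z) \<partial>lebesgue)"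
      by (subst nn_integral_add) (simp_all add: nn_integral_cmult)
    also have "\<dots> \<le> ennreal (2 powr p) * A * ?J + B * (M * ?I)"
      by (intro add_mono mult_left_mono slice) auto
    finally have 2: "(\<integral>\<^sup>+z. ennreal (gagliardo s p (\<lambda>x. \<phi> x * \<eta> x) z) \<partial>lebesgue)
        \<le> ennreal (2 powr p) * A * ?J + B * (M * ?I)" .
    have "W_norm_pow s p UNIV (\<lambda>x. \<phi> x * \<eta> x) \<le> A * ?I + (ennreal (2 powr p) * A * ?J + B * (M * ?I))"
      by (subst W_norm_pow_UNIV) (use 1 2 in \<open>auto intro: add_mono\<close>)
    also have "\<dots> \<le> A * (?I + ?J) + (ennreal (2 powr p) * A * (?I + ?J) + B * (M * (?I + ?J)))"
      by (intro add_mono mult_left_mono) auto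
    also have "\<dots> = C * (?I + ?J)"
      by (simp add: C_def distrib_right mult.assoc add.assoc)
    finally show ?thesis
      by (simp add: Wpsi)
  qed
  ultimately show ?thesis
    by (intro exI[of _ C]) simp
qed

text \<open>
  Let \<open>S\<close> be the support.  The Gagliardo integrand vanishes unless \<open>x\<close> or \<open>y\<close> lies in \<open>S\<close>, and each of
  these two regions contributes at most the slice bound times the measure of \<open>S\<close>.
\<close>
lemma Cc_infty_W_norm_pow_finite:
  fixes \<phi> :: "'a::euclidean_space \<Rightarrow> real" and s p :: real
  assumes sp: "0 < s" "s < 1" "0 < p"
    and \<phi>: "\<phi> \<in> Cc_infty G"
  shows "W_norm_pow s p UNIV \<phi> < \<infinity>"
proof -
  define S where "S = closure {x. \<phi> x \<noteq> 0}"
  have S: "compact S"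
    using \<phi> by (auto simp: Cc_infty_def S_def)
  have out: "\<phi> x = 0" if "x \<notin> S" for x
    using that closure_subset[of "{x. \<phi> x \<noteq> 0}"] by (auto simp: S_def)
  obtain L where L: "L > 0" "\<And>x. \<bar>\<phi> x\<bar> \<le> L"
    using Cc_infty_Lipschitz_bounded[OF \<phi>] by metis
  obtain M where M: "M < \<infinity>"
    "\<And>y. (\<integral>\<^sup>+x. ennreal (\<bar>\<phi> x - \<phi> y\<bar> powr p / norm (x - y) powr (real DIM('a) + s * p)) \<partial>lebesgue) \<le> M"
    using Gagliardo_slice_bound[OF sp \<phi>] by metis
  have \<phi>m: "\<phi> \<in> borel_measurable lebesgue"
    using \<phi> by (rule Cc_infty_measurable)
  note [measurable] = gagliardo_measurable[OF \<phi>m]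
  have Sm: "S \<in> sets lebesgue"
    using S by (simp add: borel_compact)
  have Sfin: "emeasure lebesgue S < \<infinity>"
    using emeasure_compact_finite[OF S] borel_compact[OF S] by simp
  have "(\<integral>\<^sup>+x. ennreal (\<bar>\<phi> x\<bar> powr p) \<partial>lebesgue) \<le> (\<integral>\<^sup>+x. ennreal (L powr p) * indicator S x \<partial>lebesgue)"
    using out L sp by (intro nn_integral_mono) (auto split: split_indicator intro!: ennreal_leI powr_mono2)
  also have "\<dots> < \<infinity>"
    using Sm Sfin by (simp add: nn_integral_cmult_indicator ennreal_mult_less_top)
  finally have 1: "(\<integral>\<^sup>+x. ennreal (\<bar>\<phi> x\<bar> powr p) \<partial>lebesgue) < \<infinity>" .
  have V: "V_norm_pow s p S \<phi> < \<infinity>"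
  proof -
    have "(\<integral>\<^sup>+x\<in>S. (\<integral>\<^sup>+y.
        ennreal (\<bar>\<phi> x - \<phi> y\<bar> powr p / norm (x - y) powr (real DIM('a) + s * p)) \<partial>lebesgue) \<partial>lebesgue)
      \<le> (\<integral>\<^sup>+x\<in>S. M \<partial>lebesgue)"
      using M(2) by (intro nn_integral_mono mult_right_mono) (simp_all add: abs_minus_commute norm_minus_commute)
    also have "\<dots> < \<infinity>"
      using Sm Sfin M(1) by (simp add: nn_integral_cmult_indicator ennreal_mult_less_top)
    finally have "(\<integral>\<^sup>+x\<in>S. (\<integral>\<^sup>+y.
        ennreal (\<bar>\<phi> x - \<phi> y\<bar> powr p / norm (x - y) powr (real DIM('a) + s * p)) \<partial>lebesgue) \<partial>lebesgue) < \<infinity>" .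
    moreover have "(\<integral>\<^sup>+x\<in>S. ennreal (\<bar>\<phi> x\<bar> powr p) \<partial>lebesgue) \<le> (\<integral>\<^sup>+x. ennreal (\<bar>\<phi> x\<bar> powr p) \<partial>lebesgue)"
      by (intro nn_integral_mono) (auto split: split_indicator)
    ultimately show ?thesis
      using 1 by (auto simp: V_norm_pow_def dest: le_less_trans)
  qed
  have "(\<integral>\<^sup>+z. ennreal (gagliardo s p \<phi> z) \<partial>lebesgue) \<le>
      (\<integral>\<^sup>+z. ennreal (gagliardo s p \<phi> z) * indicator (S \<times> UNIV) z
        + ennreal (gagliardo s p \<phi> z) * indicator (UNIV \<times> S) z \<partial>lebesgue)"
    by (intro nn_integral_mono) (use out in \<open>force simp: gagliardo_def split: split_indicator\<close>)
  also have "\<dots> = (\<integral>\<^sup>+z\<in>S \<times> UNIV. ennreal (gagliardo s p \<phi> z) \<partial>lebesgue)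
      + (\<integral>\<^sup>+z\<in>UNIV \<times> S. ennreal (gagliardo s p \<phi> z) \<partial>lebesgue)"
  proof (rule nn_integral_add)
    have "S \<times> (UNIV :: 'a set) \<in> sets borel" "(UNIV :: 'a set) \<times> S \<in> sets borel"
      using borel_compact[OF S] by (auto intro: borel_Times)
    then have [measurable]: "S \<times> (UNIV :: 'a set) \<in> sets lebesgue" "(UNIV :: 'a set) \<times> S \<in> sets lebesgue"
      by auto
    show "(\<lambda>z. ennreal (gagliardo s p \<phi> z) * indicator (S \<times> UNIV) z) \<in> borel_measurable lebesgue"
      "(\<lambda>z. ennreal (gagliardo s p \<phi> z) * indicator (UNIV \<times> S) z) \<in> borel_measurable lebesgue"
      by measurable
  qed
  also have "\<dots> < \<infinity>"
    using V V_norm_pow_product[OF \<phi>m Sm, of s p] by auto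
  finally show ?thesis
    using 1 by (subst W_norm_pow_UNIV[OF \<phi>m]) simp
qed

section \<open>The energy\<close>

text \<open>
  Young's inequality with a small parameter: compare \<open>b\<close> with \<open>\<delta> a\<close>.
\<close>
lemma powr_Young:
  fixes a b \<delta> p :: real
  assumes "0 \<le> a" "0 \<le> b" "0 < \<delta>" "1 < p"
  shows "a powr (p - 1) * b \<le> \<delta> * a powr p + \<delta> powr (1 - p) * b powr p"
proof -
  have step: "c powr (p - 1) * c = c powr p" if "0 \<le> c" for c :: real
    using that powr_add[of c "p - 1" 1] by (cases "c = 0") (auto simp: powr_one)
  show ?thesis
  proof (cases "b \<le> \<delta> * a")
    case True
    have "a powr (p - 1) * b \<le> a powr (p - 1) * (\<delta> * a)"
      using True by (intro mult_left_mono) auto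
    also have "\<dots> = \<delta> * a powr p"
      using step[OF assms(1)] by (simp add: mult.left_commute)
    finally show ?thesis
      by (simp add: add_increasing2)
  next
    case False
    then have "a \<le> b / \<delta>"
      using assms by (simp add: field_simps)
    then have "a powr (p - 1) * b \<le> (b / \<delta>) powr (p - 1) * b"
      using assms by (intro mult_right_mono powr_mono2) auto
    also have "\<dots> = \<delta> powr (1 - p) * (b powr (p - 1) * b)"
      using assms powr_minus_divide[of \<delta> "p - 1"] by (simp add: powr_divide)
    also have "\<dots> = \<delta> powr (1 - p) * b powr p"
      using step[OF assms(2)] by simp
    finally show ?thesis
      using assms by (simp add: add_increasing)
  qed
qed

definition energy_density ::
  "('a::euclidean_space \<Rightarrow> 'a \<Rightarrow> ennreal) \<Rightarrow> real \<Rightarrow> ('a \<Rightarrow> real) \<Rightarrow> ('a \<Rightarrow> real) \<Rightarrow> 'a \<times> 'a \<Rightarrow> real" where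
  "energy_density k p u v z = \<bar>u (fst z) - u (snd z)\<bar> powr (p - 2) * (u (fst z) - u (snd z)) *
     (v (fst z) - v (snd z)) * enn2real (k (fst z) (snd z))"

lemma abs_energy_density_le:
  fixes u v :: "'a::euclidean_space \<Rightarrow> real"
  assumes k: "nonlocal_kernel s p \<Lambda> k" and "1 < p" "1 \<le> \<Lambda>" "0 < \<delta>"
  shows "\<bar>energy_density k p u v z\<bar>
    \<le> \<Lambda> * (\<delta> * gagliardo s p u z + \<delta> powr (1 - p) * gagliardo s p v z)"
proof -
  obtain x y where z: "z = (x, y)" by (cases z)
  define N where "N = real DIM('a) + s * p"
  have rhs: "0 \<le> \<Lambda> * (\<delta> * gagliardo s p u z + \<delta> powr (1 - p) * gagliardo s p v z)"
    using assms by (intro mult_nonneg_nonneg add_nonneg_nonneg gagliardo_nonneg) auto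
  show ?thesis
  proof (cases "x = y")
    case True
    then show ?thesis using rhs by (simp add: energy_density_def z)
  next
    case False
    have "k x y \<le> ennreal (\<Lambda> * norm (x - y) powr (- real DIM('a) - s * p))"
      using k False by (auto simp: nonlocal_kernel_def)
    moreover have "- real DIM('a) - s * p = - N"
      by (simp add: N_def)
    ultimately have "k x y \<le> ennreal (\<Lambda> / norm (x - y) powr N)"
      by (simp add: powr_minus_divide)
    then have kle: "enn2real (k x y) \<le> \<Lambda> / norm (x - y) powr N"
      using assms by (intro enn2real_leI) auto
    have eq: "\<bar>t\<bar> powr (p - 2) * \<bar>t\<bar> = \<bar>t\<bar> powr (p - 1)" for t :: real
      using powr_add[of "\<bar>t\<bar>" "p - 2" 1] by (cases "t = 0") (auto simp: powr_one)
    have "\<bar>energy_density k p u v z\<bar> = \<bar>u x - u y\<bar> powr (p - 1) * \<bar>v x - v y\<bar> * enn2real (k x y)"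
      by (simp add: energy_density_def z abs_mult eq)
    also have "\<dots> \<le> (\<delta> * \<bar>u x - u y\<bar> powr p + \<delta> powr (1 - p) * \<bar>v x - v y\<bar> powr p) *
        (\<Lambda> / norm (x - y) powr N)"
      using assms kle by (intro mult_mono powr_Young) auto
    also have "\<dots> = \<Lambda> * (\<delta> * gagliardo s p u z + \<delta> powr (1 - p) * gagliardo s p v z)"
      by (simp add: z gagliardo_def N_def[symmetric] distrib_left distrib_right add_divide_distrib
          mult.assoc) (simp add: mult_ac)
    finally show ?thesis .
  qed
qed

lemma energy_density_measurable:
  fixes u v :: "'a::euclidean_space \<Rightarrow> real"
  assumes k: "nonlocal_kernel s p \<Lambda> k"
    and u: "u \<in> borel_measurable lebesgue" and v: "v \<in> borel_measurable lebesgue"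
  shows "energy_density k p u v \<in> borel_measurable lebesgue"
proof -
  have [measurable]: "(\<lambda>z::'a \<times> 'a. u (fst z)) \<in> borel_measurable lebesgue"
    "(\<lambda>z::'a \<times> 'a. u (snd z)) \<in> borel_measurable lebesgue"
    "(\<lambda>z::'a \<times> 'a. v (fst z)) \<in> borel_measurable lebesgue"
    "(\<lambda>z::'a \<times> 'a. v (snd z)) \<in> borel_measurable lebesgue"
    using measurable_compose[OF measurable_fst_snd_lebesgue(1) u]
      measurable_compose[OF measurable_fst_snd_lebesgue(2) u]
      measurable_compose[OF measurable_fst_snd_lebesgue(1) v]
      measurable_compose[OF measurable_fst_snd_lebesgue(2) v] by auto
  have "(\<lambda>z. k (fst z) (snd z)) \<in> borel_measurable lebesgue"
    using k unfolding nonlocal_kernel_def case_prod_beta by blast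
  then have [measurable]: "(\<lambda>z. enn2real (k (fst z) (snd z))) \<in> borel_measurable lebesgue"
    by measurable
  show ?thesis
    unfolding energy_density_def[abs_def] by measurable
qed

text \<open>
  As \<open>v\<close> vanishes outside \<open>G\<close>, the density vanishes unless one of the two variables is in \<open>G\<close>.  This
  is why a \<open>V\<close>-norm of \<open>u\<close> over \<open>G\<close>, instead of a Sobolev norm on the whole space, suffices.
\<close>
lemma nn_integral_energy_density_le:
  fixes u v :: "'a::euclidean_space \<Rightarrow> real"
  assumes k: "nonlocal_kernel s p \<Lambda> k" and p: "1 < p" "1 \<le> \<Lambda>" "0 < \<delta>"
    and u: "u \<in> borel_measurable lebesgue" and v: "v \<in> borel_measurable lebesgue"
    and G: "open G" and v0: "\<And>x. x \<notin> G \<Longrightarrow> v x = 0"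
  shows "(\<integral>\<^sup>+z. ennreal \<bar>energy_density k p u v z\<bar> \<partial>lebesgue)
    \<le> ennreal (2 * \<Lambda> * \<delta>) * V_norm_pow s p G u
      + ennreal (2 * \<Lambda> * \<delta> powr (1 - p)) * W_norm_pow s p UNIV v"
proof -
  define a where "a = ennreal (\<Lambda> * \<delta>)"
  define b where "b = ennreal (\<Lambda> * \<delta> powr (1 - p))"
  let ?U = "\<lambda>z. ennreal (gagliardo s p u z)" and ?V = "\<lambda>z. ennreal (gagliardo s p v z)"
  note [measurable] = gagliardo_measurable[OF u] gagliardo_measurable[OF v]
  have "G \<times> (UNIV :: 'a set) \<in> sets borel" "(UNIV :: 'a set) \<times> G \<in> sets borel"
    using G by (auto intro!: borel_Times)
  then have [measurable]: "G \<times> (UNIV :: 'a set) \<in> sets lebesgue" "(UNIV :: 'a set) \<times> G \<in> sets lebesgue"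
    by auto
  have dens: "ennreal \<bar>energy_density k p u v z\<bar> \<le> a * ?U z + b * ?V z" for z
  proof -
    have "ennreal \<bar>energy_density k p u v z\<bar>
        \<le> ennreal ((\<Lambda> * \<delta>) * gagliardo s p u z + (\<Lambda> * \<delta> powr (1 - p)) * gagliardo s p v z)"
      using abs_energy_density_le[OF k p, of u v z] by (intro ennreal_leI) (simp add: algebra_simps)
    also have "\<dots> = a * ?U z + b * ?V z"
      using p by (simp add: a_def b_def gagliardo_nonneg ennreal_mult[symmetric] ennreal_plus[symmetric]
          del: ennreal_plus)
    finally show ?thesis .
  qed
  have zero: "energy_density k p u v z = 0" if "z \<notin> G \<times> UNIV" "z \<notin> UNIV \<times> G" for z
    using that v0 by (cases z) (auto simp: energy_density_def)
  have "ennreal \<bar>energy_density k p u v z\<bar> \<le> a * (?U z * indicator (G \<times> UNIV) z) +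
      a * (?U z * indicator (UNIV \<times> G) z) + 2 * (b * ?V z)" for z
  proof (cases "z \<in> G \<times> UNIV \<or> z \<in> UNIV \<times> G")
    case True
    have "a * ?U z \<le> a * (?U z * indicator (G \<times> UNIV) z) + a * (?U z * indicator (UNIV \<times> G) z)"
      using True by (auto split: split_indicator simp: add_increasing add_increasing2)
    moreover have "b * ?V z \<le> 2 * (b * ?V z)"
      by (simp add: mult_2 add_increasing)
    ultimately show ?thesis
      using dens[of z] by (meson add_mono order_trans)
  next
    case False
    then show ?thesis using zero[of z] by simp
  qed
  then have "(\<integral>\<^sup>+z. ennreal \<bar>energy_density k p u v z\<bar> \<partial>lebesgue)
      \<le> (\<integral>\<^sup>+z. a * (?U z * indicator (G \<times> UNIV) z) + a * (?U z * indicator (UNIV \<times> G) z)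
        + 2 * (b * ?V z) \<partial>lebesgue)"
    by (rule nn_integral_mono)
  also have "\<dots> = a * (\<integral>\<^sup>+z\<in>G \<times> UNIV. ?U z \<partial>lebesgue) + a * (\<integral>\<^sup>+z\<in>UNIV \<times> G. ?U z \<partial>lebesgue)
      + 2 * (b * (\<integral>\<^sup>+z. ?V z \<partial>lebesgue))"
    by (simp add: nn_integral_add nn_integral_cmult)
  also have "\<dots> \<le> a * V_norm_pow s p G u + a * V_norm_pow s p G u + 2 * (b * W_norm_pow s p UNIV v)"
  proof (intro add_mono mult_left_mono)
    show "(\<integral>\<^sup>+z\<in>G \<times> UNIV. ?U z \<partial>lebesgue) \<le> V_norm_pow s p G u"
      by (subst V_norm_pow_product(1)[OF u]) (use G in auto)
    show "(\<integral>\<^sup>+z\<in>UNIV \<times> G. ?U z \<partial>lebesgue) \<le> V_norm_pow s p G u"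
      by (subst V_norm_pow_product(2)[OF u]) (use G in auto)
    show "(\<integral>\<^sup>+z. ?V z \<partial>lebesgue) \<le> W_norm_pow s p UNIV v"
      by (subst W_norm_pow_UNIV[OF v]) auto
  qed auto
  also have "\<dots> = (2 * a) * V_norm_pow s p G u + (2 * b) * W_norm_pow s p UNIV v"
    by (simp add: mult_2 distrib_right)
  also have "2 * a = ennreal (2 * \<Lambda> * \<delta>)"
    using p by (simp add: a_def ennreal_mult mult.assoc)
  also have "2 * b = ennreal (2 * \<Lambda> * \<delta> powr (1 - p))"
    using p by (simp add: b_def ennreal_mult mult.assoc)
  finally show ?thesis .
qed

text \<open>
  The energy is an iterated integral; absolute convergence makes it an integral over the product and so
  additive in the test function.  The free parameter \<open>\<delta>\<close> in the last estimate replaces Hoelder's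
  inequality: first \<open>\<delta>\<close> and then \<open>v\<close> is taken small.
\<close>
lemma energy_product:
  fixes u v :: "'a::euclidean_space \<Rightarrow> real"
  assumes k: "nonlocal_kernel s p \<Lambda> k" and p: "1 < p" "1 \<le> \<Lambda>"
    and u: "u \<in> borel_measurable lebesgue" and v: "v \<in> borel_measurable lebesgue"
    and G: "open G" and v0: "\<And>x. x \<notin> G \<Longrightarrow> v x = 0"
    and fin: "V_norm_pow s p G u < \<infinity>" "W_norm_pow s p UNIV v < \<infinity>"
  shows "integrable lebesgue (energy_density k p u v)"
    and "energy k p u v = (LINT z|lebesgue. energy_density k p u v z)"
    and "0 < \<delta> \<Longrightarrow> \<bar>energy k p u v\<bar> \<le> 2 * \<Lambda> * \<delta> * enn2real (V_norm_pow s p G u)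
      + 2 * \<Lambda> * \<delta> powr (1 - p) * enn2real (W_norm_pow s p UNIV v)"
proof -
  have bound: "(\<integral>\<^sup>+z. ennreal \<bar>energy_density k p u v z\<bar> \<partial>lebesgue)
    \<le> ennreal (2 * \<Lambda> * \<delta> * enn2real (V_norm_pow s p G u)
      + 2 * \<Lambda> * \<delta> powr (1 - p) * enn2real (W_norm_pow s p UNIV v))" if "0 < \<delta>" for \<delta>
    using nn_integral_energy_density_le[OF k p that u v G v0] fin p that
    by (simp add: ennreal_plus ennreal_mult)
  have "(\<integral>\<^sup>+z. ennreal (norm (energy_density k p u v z)) \<partial>lebesgue) < \<infinity>"
    using bound[of 1] by (auto intro: le_less_trans)
  then show int: "integrable lebesgue (energy_density k p u v)"
    by (rule integrableI_bounded[OF energy_density_measurable[OF k u v]])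
  from integral_lebesgue_Fubini[OF int]
  show eq: "energy k p u v = (LINT z|lebesgue. energy_density k p u v z)"
    by (simp add: energy_def energy_density_def)
  show "\<bar>energy k p u v\<bar> \<le> 2 * \<Lambda> * \<delta> * enn2real (V_norm_pow s p G u)
      + 2 * \<Lambda> * \<delta> powr (1 - p) * enn2real (W_norm_pow s p UNIV v)" if "0 < \<delta>"
  proof -
    have "ennreal (norm (LINT z|lebesgue. energy_density k p u v z))
        \<le> (\<integral>\<^sup>+z. ennreal (norm (energy_density k p u v z)) \<partial>lebesgue)"
      by (rule integral_norm_bound_ennreal[OF int])
    also have "\<dots> \<le> ennreal (2 * \<Lambda> * \<delta> * enn2real (V_norm_pow s p G u)
      + 2 * \<Lambda> * \<delta> powr (1 - p) * enn2real (W_norm_pow s p UNIV v))"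
      using bound[OF that] by simp
    finally show ?thesis
      using p that unfolding eq by (subst (asm) ennreal_le_iff) auto
  qed
qed

lemma energy_add:
  fixes u v w :: "'a::euclidean_space \<Rightarrow> real"
  assumes k: "nonlocal_kernel s p \<Lambda> k" and p: "1 < p" "1 \<le> \<Lambda>"
    and u: "u \<in> borel_measurable lebesgue" "V_norm_pow s p G u < \<infinity>" and G: "open G"
    and v: "v \<in> borel_measurable lebesgue" "W_norm_pow s p UNIV v < \<infinity>" "\<And>x. x \<notin> G \<Longrightarrow> v x = 0"
    and w: "w \<in> borel_measurable lebesgue" "W_norm_pow s p UNIV w < \<infinity>" "\<And>x. x \<notin> G \<Longrightarrow> w x = 0"
    and vw: "W_norm_pow s p UNIV (\<lambda>x. v x + w x) < \<infinity>"
  shows "energy k p u (\<lambda>x. v x + w x) = energy k p u v + energy k p u w"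
proof -
  note V = energy_product[OF k p u(1) v(1) G v(3) u(2) v(2)]
  note W = energy_product[OF k p u(1) w(1) G w(3) u(2) w(2)]
  have m: "(\<lambda>x. v x + w x) \<in> borel_measurable lebesgue"
    using v(1) w(1) by measurable
  have "energy k p u (\<lambda>x. v x + w x) = (LINT z|lebesgue. energy_density k p u (\<lambda>x. v x + w x) z)"
    by (rule energy_product(2)[OF k p u(1) m G _ u(2) vw]) (use v(3) w(3) in auto)
  also have "\<dots> = (LINT z|lebesgue. energy_density k p u v z + energy_density k p u w z)"
    by (intro Bochner_Integration.integral_cong) (auto simp: energy_density_def algebra_simps)
  also have "\<dots> = energy k p u v + energy k p u w"
    using V(1,2) W(1,2) by simp
  finally show ?thesis .
qed

section \<open>Sets of zero capacity\<close>

text \<open>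
  A compact subset of \<open>E\<close> lies in every open superset of \<open>E\<close>, so its capacity is at most that of \<open>E\<close>.
\<close>
lemma capacity_zero_compact_competitor:
  assumes cap: "sobolev_cap s p E = 0" and K: "compact K" "K \<subseteq> E" and e: "0 < e"
  obtains \<psi> where "\<psi> \<in> Cc_infty UNIV" "\<And>x. x \<in> K \<Longrightarrow> 1 \<le> \<psi> x" "W_norm_pow s p UNIV \<psi> < e"
proof -
  have "cap_compact s p K \<le> sobolev_cap s p E"
    unfolding sobolev_cap_def cap_open_def
    by (rule INF_greatest, rule SUP_upper) (use K in auto)
  then have "cap_compact s p K < e"
    using cap e by simp
  then show thesis
    unfolding cap_compact_def INF_less_iff using that by auto
qed

text \<open>
  A competitor \<open>\<psi> \<ge> 1\<close> on a compact \<open>K\<close> gives \<open>\<bar>K\<bar> \<le> \<integral> \<bar>\<psi>\<bar>^p\<close>, so compact subsets of \<open>E\<close> are null; and a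
  relatively closed subset of an open set is a countable union of compact sets.
\<close>
lemma capacity_zero_imp_null:
  fixes E \<Omega> :: "'a::euclidean_space set"
  assumes "0 < p" and cap: "sobolev_cap s p E = 0"
    and \<Omega>: "open \<Omega>" and E: "closedin (top_of_set \<Omega>) E"
  shows "E \<in> null_sets lebesgue"
proof -
  have compact_null: "K \<in> null_sets lebesgue" if K: "compact K" "K \<subseteq> E" for K
  proof -
    have Km: "K \<in> sets lebesgue"
      using borel_compact[OF K(1)] by simp
    have "emeasure lebesgue K \<le> e" if e: "0 < e" for e :: ennreal
    proof -
      obtain \<psi> where \<psi>: "\<psi> \<in> Cc_infty UNIV" "\<And>x. x \<in> K \<Longrightarrow> 1 \<le> \<psi> x" "W_norm_pow s p UNIV \<psi> < e"
        using capacity_zero_compact_competitor[OF cap K e] by metis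
      have "emeasure lebesgue K = (\<integral>\<^sup>+x. indicator K x \<partial>lebesgue)"
        using Km by simp
      also have "\<dots> \<le> (\<integral>\<^sup>+x. ennreal (\<bar>\<psi> x\<bar> powr p) \<partial>lebesgue)"
      proof (intro nn_integral_mono)
        fix x
        show "indicator K x \<le> ennreal (\<bar>\<psi> x\<bar> powr p)"
          using \<psi>(2)[of x] \<open>0 < p\<close> by (auto split: split_indicator simp: ge_one_powr_ge_zero)
      qed
      also have "\<dots> \<le> W_norm_pow s p UNIV \<psi>"
        by (simp add: W_norm_pow_def)
      finally show ?thesis
        using \<psi>(3) by simp
    qed
    then have "emeasure lebesgue K \<le> 0"
      by (rule dense_ge) auto
    then show ?thesis
      using Km by (simp add: null_sets_def)
  qed
  obtain T where T: "closed T" "E = \<Omega> \<inter> T"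
    using E by (auto simp: closedin_closed)
  obtain \<D> where \<D>: "countable \<D>" "\<And>X. X \<in> \<D> \<Longrightarrow> \<exists>a b. X = cbox a b" "\<Union>\<D> = \<Omega>"
    using open_countable_Union_open_cbox[OF \<Omega>] by metis
  have "(\<Union>X\<in>\<D>. X \<inter> T) \<in> null_sets lebesgue"
  proof (rule null_sets_UN'[OF \<D>(1)])
    fix X assume X: "X \<in> \<D>"
    then have "compact X"
      using \<D>(2) compact_cbox by metis
    then have "compact (X \<inter> T)"
      using T by (simp add: compact_Int_closed)
    moreover have "X \<inter> T \<subseteq> E"
      using X \<D>(3) T by auto
    ultimately show "X \<inter> T \<in> null_sets lebesgue"
      by (rule compact_null)
  qed
  moreover have "(\<Union>X\<in>\<D>. X \<inter> T) = E"
    using \<D>(3) T by auto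
  ultimately show ?thesis by simp
qed

lemma V_norm_pow_Diff_null:
  assumes "E \<in> null_sets lebesgue"
  shows "V_norm_pow s p (G - E) u = V_norm_pow s p G u"
proof -
  have ae: "AE x in lebesgue. x \<notin> E"
    using assms by (rule AE_not_in)
  have "(\<integral>\<^sup>+x\<in>G - E. F x \<partial>lebesgue) = (\<integral>\<^sup>+x\<in>G. F x \<partial>lebesgue)" for F :: "'a \<Rightarrow> ennreal"
    by (rule nn_integral_cong_AE) (use ae in \<open>eventually_elim, auto split: split_indicator\<close>)
  then show ?thesis
    unfolding V_norm_pow_def by simp
qed

text \<open>
  With the null set \<open>E\<close> removed from the domain of integration at no cost, this gives the membership
  in \<open>W_loc s p \<Omega>\<close> that a solution in \<open>\<Omega>\<close> must have.
\<close>
lemma V_space_imp_W_loc: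
  assumes "open \<Omega>" and u: "u \<in> V_space s p \<Omega>"
  shows "u \<in> W_loc s p \<Omega>"
  unfolding W_loc_def
proof (intro CollectI allI impI)
  fix G :: "'a set" assume G: "open G \<and> compact (closure G) \<and> closure G \<subseteq> \<Omega>"
  then have sub: "G \<subseteq> \<Omega>"
    using closure_subset by blast
  let ?w = "real_of_ereal \<circ> u"
  have mono: "(\<integral>\<^sup>+x\<in>G. F x \<partial>lebesgue) \<le> (\<integral>\<^sup>+x\<in>\<Omega>. H x \<partial>lebesgue)"
    if "\<And>x. F x \<le> H x" for F H :: "'a \<Rightarrow> ennreal"
    using sub that by (intro nn_integral_mono) (auto split: split_indicator)
  have "W_norm_pow s p G ?w \<le> V_norm_pow s p \<Omega> ?w"
    unfolding W_norm_pow_def V_norm_pow_def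
    by (intro add_mono mono nn_integral_mono) (auto split: split_indicator)
  also have "\<dots> < \<infinity>"
    using u by (simp add: V_space_def)
  finally have fin: "W_norm_pow s p G ?w < \<infinity>" .
  have um: "u \<in> borel_measurable lebesgue" and ae: "AE x in lebesgue. \<bar>u x\<bar> \<noteq> \<infinity>"
    using u by (auto simp: V_space_def)
  have "u \<in> borel_measurable (lebesgue_on G)"
    using um by (rule measurable_restrict_space1)
  moreover have "AE x in lebesgue. x \<in> G \<longrightarrow> \<bar>u x\<bar> \<noteq> \<infinity>"
    using ae by eventually_elim simp
  ultimately show "u \<in> W_space s p G"
    using fin by (simp add: W_space_def)
qed

section \<open>Removability\<close>

text \<open>
  The factor \<open>cutoff \<circ> \<psi>\<close> vanishes where \<open>\<psi> > 1 / 2\<close>, an open set containing the part of \<open>E\<close> in the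
  support of \<open>\<phi>\<close>, so the closed support of the product misses \<open>E\<close>.
\<close>
lemma Cc_infty_cutoff:
  fixes \<phi> \<psi> :: "'a::euclidean_space \<Rightarrow> real"
  assumes \<phi>: "\<phi> \<in> Cc_infty \<Omega>" and \<psi>: "\<psi> \<in> Cc_infty UNIV"
  shows "(\<And>x. x \<in> closure {x. \<phi> x \<noteq> 0} \<inter> E \<Longrightarrow> 1 \<le> \<psi> x) \<Longrightarrow>
      (\<lambda>x. \<phi> x * cutoff (\<psi> x)) \<in> Cc_infty (\<Omega> - E)"
    and "(\<lambda>x. \<phi> x * (1 - cutoff (\<psi> x))) \<in> Cc_infty \<Omega>"
proof -
  let ?S = "closure {x. \<phi> x \<noteq> 0}"
  have S: "compact ?S" "?S \<subseteq> \<Omega>" and C: "C_k m \<phi>" "C_k m \<psi>" for m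
    using \<phi> \<psi> unfolding Cc_infty_def by blast+
  have support: "compact (closure {x. \<phi> x * h x \<noteq> 0})" "closure {x. \<phi> x * h x \<noteq> 0} \<subseteq> ?S" for h
  proof -
    show sub: "closure {x. \<phi> x * h x \<noteq> 0} \<subseteq> ?S"
      by (rule closure_mono) auto
    show "compact (closure {x. \<phi> x * h x \<noteq> 0})"
      using compact_Int_closed[OF S(1) closed_closure, of "{x. \<phi> x * h x \<noteq> 0}"]
      by (simp only: Int_absorb1[OF sub])
  qed
  have smooth: "C_k m (\<lambda>x. \<phi> x * cutoff (\<psi> x))" for m
    by (intro C_k_mult C_k_cutoff_comp C)
  have vanish: "closure {x. \<phi> x * cutoff (\<psi> x) \<noteq> 0} \<subseteq> \<Omega> - E"
    if ge: "\<And>x. x \<in> ?S \<inter> E \<Longrightarrow> 1 \<le> \<psi> x"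
  proof -
    have "continuous_on UNIV \<psi>"
      using C(2)[of 0] by simp
    then have "closed {x. \<psi> x \<le> 1 / 2}"
      by (intro closed_Collect_le) auto
    moreover have "{x. \<phi> x * cutoff (\<psi> x) \<noteq> 0} \<subseteq> {x. \<psi> x \<le> 1 / 2}"
    proof (rule subsetI, rule CollectI, rule ccontr)
      fix x assume "x \<in> {x. \<phi> x * cutoff (\<psi> x) \<noteq> 0}" "\<not> \<psi> x \<le> 1 / 2"
      then show False
        using cutoff_eq_0[of "\<psi> x"] by simp
    qed
    ultimately have "closure {x. \<phi> x * cutoff (\<psi> x) \<noteq> 0} \<subseteq> {x. \<psi> x \<le> 1 / 2}"
      by (rule closure_minimal[rotated])
    moreover have "\<not> \<psi> x \<le> 1 / 2" if "x \<in> ?S \<inter> E" for x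
      using ge[OF that] by simp
    ultimately show ?thesis
      using support(2)[of "\<lambda>x. cutoff (\<psi> x)"] S(2) by blast
  qed
  show "(\<lambda>x. \<phi> x * cutoff (\<psi> x)) \<in> Cc_infty (\<Omega> - E)" if "\<And>x. x \<in> ?S \<inter> E \<Longrightarrow> 1 \<le> \<psi> x"
    using smooth vanish[OF that] support(1)[of "\<lambda>x. cutoff (\<psi> x)"] unfolding Cc_infty_def by auto
  have "C_k m (\<lambda>x. \<phi> x * (1 + (- 1) * cutoff (\<psi> x)))" for m
    by (intro C_k_mult C_k_add C_k_const C_k_cutoff_comp C)
  then show "(\<lambda>x. \<phi> x * (1 - cutoff (\<psi> x))) \<in> Cc_infty \<Omega>"
    using support[of "\<lambda>x. 1 - cutoff (\<psi> x)"] S(2) unfolding Cc_infty_def by auto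
qed

lemma Cc_infty_subset_V0_space:
  assumes sp: "0 < s" "s < 1" "0 < p" and \<phi>: "\<phi> \<in> Cc_infty G"
  shows "\<phi> \<in> V0_space s p G"
proof -
  have "V_norm_pow s p G \<phi> < \<infinity>"
    using V_norm_pow_le_W_norm_pow Cc_infty_W_norm_pow_finite[OF sp \<phi>] by (rule le_less_trans)
  then have "(\<lambda>x. ereal (\<phi> x)) \<in> V_space s p G"
    using Cc_infty_measurable[OF \<phi>] by (simp add: V_space_def comp_def)
  moreover have "\<phi> x = 0" if "x \<notin> G" for x
    using \<phi> that closure_subset[of "{x. \<phi> x \<noteq> 0}"] by (auto simp: Cc_infty_def)
  moreover have "V_norm s p G (\<lambda>x. \<phi> x - \<phi> x) = 0"
    using sp by (simp add: V_norm_def V_norm_pow_def)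
  ultimately show ?thesis
    using \<phi> unfolding V0_space_def by force
qed

text \<open>
  The approximation argument.  A competitor \<open>\<psi>\<close> for the compact set where \<open>E\<close> meets the support of \<open>\<phi>\<close>
  splits \<open>\<phi>\<close> into \<open>v = \<phi> (cutoff \<circ> \<psi>)\<close>, at which the inequality is assumed, and
  \<open>w = \<phi> (1 - cutoff \<circ> \<psi>)\<close>, whose Sobolev norm is at most a constant times that of \<open>\<psi>\<close>.  Both \<open>f\<close> and
  the energy are additive, and both are small at \<open>w\<close>.  The hypothesis speaks of the products with
  \<open>cutoff \<circ> \<psi>\<close> only, rather than of all test functions in \<open>\<Omega> - E\<close>, so that it can be met for
  supersolutions too: these products inherit the sign of \<open>\<phi>\<close>.
\<close>
lemma energy_ge_of_cutoff:
  fixes \<phi> :: "'a::euclidean_space \<Rightarrow> real" and s p \<Lambda> :: real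
  assumes sp: "0 < s" "s < 1" and p: "1 < p" "1 \<le> \<Lambda>"
    and k: "nonlocal_kernel s p \<Lambda> k"
    and \<Omega>: "open \<Omega>" and E: "closedin (top_of_set \<Omega>) E" and cap: "sobolev_cap s p E = 0"
    and f: "f \<in> V0_dual s p \<Omega>"
    and u: "u \<in> borel_measurable lebesgue" "V_norm_pow s p \<Omega> u < \<infinity>"
    and \<phi>: "\<phi> \<in> Cc_infty \<Omega>"
    and cut: "\<And>\<psi>. \<psi> \<in> Cc_infty UNIV \<Longrightarrow> (\<lambda>x. \<phi> x * cutoff (\<psi> x)) \<in> Cc_infty (\<Omega> - E) \<Longrightarrow>
      f (\<lambda>x. \<phi> x * cutoff (\<psi> x)) \<le> energy k p u (\<lambda>x. \<phi> x * cutoff (\<psi> x))"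
  shows "f \<phi> \<le> energy k p u \<phi>"
proof (rule field_le_epsilon)
  fix e :: real assume e: "0 < e"
  have p0: "0 < p" using p by simp
  obtain Cf where Cf: "\<And>v. v \<in> V0_space s p \<Omega> \<Longrightarrow> \<bar>f v\<bar> \<le> Cf * V_norm s p \<Omega> v"
    and f_add: "\<And>v w. v \<in> V0_space s p \<Omega> \<Longrightarrow> w \<in> V0_space s p \<Omega> \<Longrightarrow> f (\<lambda>x. v x + w x) = f v + f w"
    using f unfolding V0_dual_def by blast
  have "0 \<le> 2 * exp (2::real)" by simp
  from W_norm_pow_mult_le[OF sp p0 this \<phi>]
  obtain C where C: "C < \<infinity>" "\<forall>\<psi>\<in>borel_measurable lebesgue. \<forall>\<eta>\<in>borel_measurable lebesgue.
      (\<forall>x. \<bar>\<eta> x\<bar> \<le> 2 * exp 2 * \<bar>\<psi> x\<bar>) \<longrightarrow>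
      (\<forall>x y. \<bar>\<eta> x - \<eta> y\<bar> \<le> 2 * exp 2 * \<bar>\<psi> x - \<psi> y\<bar>) \<longrightarrow>
      W_norm_pow s p UNIV (\<lambda>x. \<phi> x * \<eta> x) \<le> C * W_norm_pow s p UNIV \<psi>"
    by (elim exE conjE)
  \<comment> \<open>\<open>\<delta>\<close> makes the part of the energy bound that carries the norm of \<open>u\<close> at most \<open>e / 3\<close>.  The first
    argument of \<open>min\<close> does the same for the part with the norm of \<open>w\<close>, the second for \<open>f w\<close>.\<close>
  define V where "V = enn2real (V_norm_pow s p \<Omega> u)"
  define \<delta> where "\<delta> = e / (6 * \<Lambda> * (V + 1))"
  define \<tau> where "\<tau> = min (e / (6 * \<Lambda> * \<delta> powr (1 - p))) ((e / (3 * (\<bar>Cf\<bar> + 1))) powr p)"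
  have V: "0 \<le> V" by (simp add: V_def)
  have \<delta>: "0 < \<delta>" using e p V by (simp add: \<delta>_def)
  have \<tau>: "0 < \<tau>" using e p \<delta> by (simp add: \<tau>_def)
  \<comment> \<open>The summand \<open>1\<close> avoids division by zero.\<close>
  define \<epsilon> where "\<epsilon> = ennreal \<tau> / (C + 1)"
  have "0 < \<epsilon>"
    using \<tau> C(1) by (simp add: \<epsilon>_def ennreal_zero_less_divide)
  define S where "S = closure {x. \<phi> x \<noteq> 0}"
  obtain T where T: "closed T" "E = \<Omega> \<inter> T"
    using E by (auto simp: closedin_closed)
  have S: "compact S" "S \<subseteq> \<Omega>"
    using \<phi> unfolding Cc_infty_def S_def by blast+
  \<comment> \<open>\<open>E\<close> need not be closed, but inside the compact support it agrees with the closed set \<open>T\<close>.\<close>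
  have "S \<inter> E = S \<inter> T"
    using S T by auto
  then have "compact (S \<inter> E)"
    using S T by (simp add: compact_Int_closed)
  then obtain \<psi> where \<psi>: "\<psi> \<in> Cc_infty UNIV" "\<And>x. x \<in> S \<inter> E \<Longrightarrow> 1 \<le> \<psi> x"
      "W_norm_pow s p UNIV \<psi> < \<epsilon>"
    using capacity_zero_compact_competitor[OF cap _ _ \<open>0 < \<epsilon>\<close>, of "S \<inter> E"] by auto
  define v where "v = (\<lambda>x. \<phi> x * cutoff (\<psi> x))"
  define w where "w = (\<lambda>x. \<phi> x * (1 - cutoff (\<psi> x)))"
  have v: "v \<in> Cc_infty (\<Omega> - E)"
    unfolding v_def by (rule Cc_infty_cutoff(1)[OF \<phi> \<psi>(1)]) (use \<psi>(2) in \<open>auto simp: S_def\<close>)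
  then have v': "v \<in> Cc_infty \<Omega>"
    by (auto simp: Cc_infty_def)
  have w: "w \<in> Cc_infty \<Omega>"
    unfolding w_def by (rule Cc_infty_cutoff(2)[OF \<phi> \<psi>(1)])
  have vw: "(\<lambda>x. v x + w x) = \<phi>"
    by (simp add: v_def w_def algebra_simps)
  have out: "g x = 0" if "g \<in> Cc_infty \<Omega>" "x \<notin> \<Omega>" for g x
    using that closure_subset[of "{x. g x \<noteq> 0}"] by (auto simp: Cc_infty_def)
  note fin = Cc_infty_W_norm_pow_finite[OF sp p0]
  note meas = Cc_infty_measurable
  have Wle: "W_norm_pow s p UNIV w \<le> ennreal \<tau>"
  proof -
    have \<eta>m: "(\<lambda>x. 1 - cutoff (\<psi> x)) \<in> borel_measurable lebesgue"
    proof -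
      have "C_k 0 (\<lambda>x. cutoff (\<psi> x))"
        using \<psi>(1) C_k_cutoff_comp unfolding Cc_infty_def by blast
      then show ?thesis
        by (auto intro!: measurable_completion borel_measurable_continuous_onI continuous_intros)
    qed
    have "W_norm_pow s p UNIV w \<le> C * W_norm_pow s p UNIV \<psi>"
      unfolding w_def
    proof (rule C(2)[rule_format, OF meas[OF \<psi>(1)] \<eta>m])
      show "\<bar>1 - cutoff (\<psi> x)\<bar> \<le> 2 * exp 2 * \<bar>\<psi> x\<bar>" for x
        using cutoff_Lipschitz[of 0 "\<psi> x"] by (simp add: cutoff_0)
      show "\<bar>(1 - cutoff (\<psi> x)) - (1 - cutoff (\<psi> y))\<bar> \<le> 2 * exp 2 * \<bar>\<psi> x - \<psi> y\<bar>" for x y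
        using cutoff_Lipschitz[of "\<psi> y" "\<psi> x"] by (simp add: abs_minus_commute)
    qed
    also have "\<dots> \<le> (C + 1) * \<epsilon>"
      using \<psi>(3) by (intro mult_mono) auto
    also have "\<dots> = ennreal \<tau>"
      using C(1) unfolding \<epsilon>_def ennreal_times_divide mult.commute[of "C + 1"]
      by (intro mult_divide_eq_ennreal) auto
    finally show ?thesis .
  qed
  then have Wr: "enn2real (W_norm_pow s p UNIV w) \<le> \<tau>"
    using \<tau> by (intro enn2real_leI) auto
  have "energy k p u \<phi> = energy k p u v + energy k p u w"
    using energy_add[OF k p u \<Omega> meas[OF v'] fin[OF v'] out[OF v'] meas[OF w] fin[OF w] out[OF w]]
      fin[OF \<phi>] by (simp add: vw)
  moreover have "f \<phi> = f v + f w"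
    using f_add[OF Cc_infty_subset_V0_space[OF sp p0 v'] Cc_infty_subset_V0_space[OF sp p0 w]]
    by (simp add: vw)
  moreover have "f v \<le> energy k p u v"
    using cut[OF \<psi>(1)] v by (simp add: v_def)
  moreover have "- energy k p u w \<le> e / 3 + e / 3"
  proof -
    have "\<bar>energy k p u w\<bar> \<le> 2 * \<Lambda> * \<delta> * V + 2 * \<Lambda> * \<delta> powr (1 - p) * enn2real (W_norm_pow s p UNIV w)"
      unfolding V_def by (rule energy_product(3)[OF k p u(1) meas[OF w] \<Omega> out[OF w] u(2) fin[OF w] \<delta>])
    also have "2 * \<Lambda> * \<delta> * V \<le> e / 3"
    proof -
      have "2 * \<Lambda> * (e / (6 * \<Lambda> * W)) * V = e / 3 * (V / W)" if "0 < W" for W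
        using p that by (simp add: field_simps)
      then have "2 * \<Lambda> * \<delta> * V = e / 3 * (V / (V + 1))"
        using V by (simp add: \<delta>_def)
      also have "\<dots> \<le> e / 3 * 1"
        using e V by (intro mult_left_mono) auto
      finally show ?thesis by simp
    qed
    also have "2 * \<Lambda> * \<delta> powr (1 - p) * enn2real (W_norm_pow s p UNIV w)
        \<le> 2 * \<Lambda> * \<delta> powr (1 - p) * (e / (6 * \<Lambda> * \<delta> powr (1 - p)))"
      using p Wr by (intro mult_left_mono) (auto simp: \<tau>_def)
    also have "\<dots> = e / 3"
      using p \<delta> by simp
    finally show ?thesis by linarith
  qed
  moreover have "f w \<le> e / 3"
  proof -
    have "enn2real (V_norm_pow s p \<Omega> w) \<le> \<tau>"
      using V_norm_pow_le_W_norm_pow[of s p \<Omega> w] Wle \<tau> by (intro enn2real_leI) auto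
    then have "V_norm s p \<Omega> w \<le> ((e / (3 * (\<bar>Cf\<bar> + 1))) powr p) powr (1 / p)"
      unfolding V_norm_def using p by (intro powr_mono2) (auto simp: \<tau>_def)
    also have "\<dots> = e / (3 * (\<bar>Cf\<bar> + 1))"
      using e p by (simp add: powr_powr)
    finally have "V_norm s p \<Omega> w \<le> e / (3 * (\<bar>Cf\<bar> + 1))" .
    moreover have "f w \<le> Cf * V_norm s p \<Omega> w"
      using Cf[OF Cc_infty_subset_V0_space[OF sp p0 w]] by simp
    moreover have "0 \<le> V_norm s p \<Omega> w"
      by (simp add: V_norm_def)
    ultimately have "f w \<le> (\<bar>Cf\<bar> + 1) * (e / (3 * (\<bar>Cf\<bar> + 1)))"
      by (smt (verit) mult_mono mult_right_mono)
    also have "\<dots> = e / 3"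
      by (simp add: field_simps add_nonneg_eq_0_iff)
    finally show ?thesis .
  qed
  ultimately show "f \<phi> \<le> energy k p u \<phi> + e"
    by linarith
qed

theorem theorem1p4:
  fixes s p \<Lambda> :: real
    and k :: "'a::euclidean_space \<Rightarrow> 'a \<Rightarrow> ennreal"
    and \<Omega> E :: "'a set"
    and f :: "('a \<Rightarrow> real) \<Rightarrow> real"
    and u :: "'a \<Rightarrow> ereal"
  assumes "0 < s" and "s < 1" and "1 < p" and "1 \<le> \<Lambda>"
    and "nonlocal_kernel s p \<Lambda> k"
    and "open \<Omega>" and "\<Omega> \<noteq> {}"
    and "closedin (top_of_set \<Omega>) E"
    and "sobolev_cap s p E = 0"
    and "f \<in> V0_dual s p \<Omega>"
    and "u \<in> V_space s p (\<Omega> - E)"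
  shows "(is_solution k s p (\<Omega> - E) f u \<longrightarrow> is_solution k s p \<Omega> f u) \<and>
         (is_supersolution k s p (\<Omega> - E) f u \<longrightarrow> is_supersolution k s p \<Omega> f u)"
proof -
  let ?w = "real_of_ereal \<circ> u"
  have "E \<in> null_sets lebesgue"
    by (rule capacity_zero_imp_null[of p s E \<Omega>]) (use assms in auto)
  then have V: "u \<in> V_space s p \<Omega>"
    using assms(11) by (simp add: V_space_def V_norm_pow_Diff_null)
  have loc: "u \<in> W_loc s p \<Omega>"
    using V_space_imp_W_loc[OF assms(6) V] .
  have "u \<in> borel_measurable lebesgue"
    using V by (simp add: V_space_def)
  then have w: "?w \<in> borel_measurable lebesgue" "V_norm_pow s p \<Omega> ?w < \<infinity>"
    using V by (auto simp: V_space_def comp_def)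
  note extend = energy_ge_of_cutoff[OF assms(1-6,8-10) w]
  have "is_solution k s p \<Omega> f u" if "is_solution k s p (\<Omega> - E) f u"
    using that loc extend unfolding is_solution_def by blast
  moreover have "is_supersolution k s p \<Omega> f u" if super: "is_supersolution k s p (\<Omega> - E) f u"
    unfolding is_supersolution_def
  proof (intro conjI ballI impI)
    show "u \<in> W_loc s p \<Omega> \<inter> L_tail s p"
      using super loc by (simp add: is_supersolution_def)
    fix \<phi> :: "'a \<Rightarrow> real" assume \<phi>: "\<phi> \<in> Cc_infty \<Omega>" "\<forall>x. 0 \<le> \<phi> x"
    show "f \<phi> \<le> energy k p ?w \<phi>"
    proof (rule extend[OF \<phi>(1)])
      fix \<psi> :: "'a \<Rightarrow> real" assume "(\<lambda>x. \<phi> x * cutoff (\<psi> x)) \<in> Cc_infty (\<Omega> - E)"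
      then show "f (\<lambda>x. \<phi> x * cutoff (\<psi> x)) \<le> energy k p ?w (\<lambda>x. \<phi> x * cutoff (\<psi> x))"
        using super \<phi>(2) by (simp add: is_supersolution_def cutoff_nonneg)
    qed
  qed
  ultimately show ?thesis by blast
qed

end
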